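(* Let $\Bbbk$ be an algebraically closed field of characteristic $0$, let $\ell\ge1$ be an integer, and let $X=\operatorname{Proj}(R_X)\subset\mathbb{P}^{n+e}_{\Bbbk}$ be a closed subscheme of dimension $n$ (so of codimension $e$), where $R_X=\Bbbk[x_0,\dots,x_{n+e}]/I_X$. Write the Hilbert series of $R_X$ as $$\sum_{i\ge0}\dim_{\Bbbk}(R_X)_i\,t^i=\frac{h_0+h_1t+\cdots+h_st^s}{(1-t)^{n+1}}.$$ If $X$ satisfies condition $\mathrm{ND}(\ell-1)$, then $h_0,h_1,\dots,h_\ell\ge0$.
   Context: $I_X=\bigoplus_{m\ge0}H^0(\mathcal{I}_{X/\mathbb{P}^{N}}(m))$, $N=n+e$, is the saturated defining ideal of $X$; dimension and codimension are defined via the Hilbert polynomial of $R_X$. By convention $h_i=0$ for $i>s$. Condition $\mathrm{ND}(k)$ (for an integer $k\ge0$): a closed subscheme $X\subset\mathbb{P}^N$ of codimension $e$ satisfies condition $\mathrm{ND}(k)$ if for each dimension $m$ with $e\le m\le N$ and a general linear subspace $\Lambda\subset\mathbb{P}^N$ of dimension $m$ one has $H^0(\mathcal{I}_{X\cap\Lambda/\Lambda}(k))=0$. *)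

theory Defs
  imports
    "HOL-Library.Poly_Mapping"
    "HOL-Computational_Algebra.Computational_Algebra"
    "HOL-Algebra.QuotRing"
    "HOL-Algebra.Embedded_Algebras"
begin

section \<open>Polynomial rings\<close>

text \<open>A monomial is a finitely supported exponent vector, and a polynomial is a finitely supported
  family of coefficients indexed by monomials. The type of variables \<open>'v\<close> may be infinite; the
  polynomial ring in a given set of variables is cut out as a carrier.\<close>

type_synonym ('v, 'k) mpoly = "('v \<Rightarrow>\<^sub>0 nat) \<Rightarrow>\<^sub>0 'k"

definition mpoly_ring :: "'v set \<Rightarrow> ('v, 'k::field) mpoly ring" where
  "mpoly_ring V = \<lparr> carrier = {p. \<forall>m\<in>Poly_Mapping.keys p. Poly_Mapping.keys m \<subseteq> V},
     mult = (*), one = 1, zero = 0, add = (+) \<rparr>"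

definition mpoly_consts :: "('v, 'k::field) mpoly set" where
  "mpoly_consts = range (Poly_Mapping.single 0)"

definition mpoly_eval :: "('v \<Rightarrow> 'k) \<Rightarrow> ('v, 'k::field) mpoly \<Rightarrow> 'k" where
  "mpoly_eval a p = (\<Sum>m\<in>Poly_Mapping.keys p. Poly_Mapping.lookup p m *
     (\<Prod>v\<in>Poly_Mapping.keys m. a v ^ Poly_Mapping.lookup m v))"

abbreviation coord_ring :: "nat \<Rightarrow> (nat, 'k::field) mpoly ring" where
  "coord_ring N \<equiv> mpoly_ring {..N}"

text \<open>The homogeneous polynomials of degree \<open>d\<close> in \<open>x\<^sub>0, \<dots>, x\<^sub>N\<close>, together with \<open>0\<close>.\<close>

definition forms :: "nat \<Rightarrow> nat \<Rightarrow> (nat, 'k::field) mpoly set" where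
  "forms N d = {p \<in> carrier (coord_ring N).
     \<forall>m\<in>Poly_Mapping.keys p. (\<Sum>v\<in>Poly_Mapping.keys m. Poly_Mapping.lookup m v) = d}"


section \<open>Closed subschemes of projective space\<close>

text \<open>Closed subschemes \<open>X\<close> of \<open>\<bbbP>\<^sup>N\<close> correspond bijectively to saturated homogeneous ideals of
  \<open>k[x\<^sub>0, \<dots>, x\<^sub>N]\<close>; throughout, \<open>X\<close> is represented by that ideal \<open>I\<^sub>X\<close>.\<close>

definition homogeneous_ideal :: "nat \<Rightarrow> (nat, 'k::field) mpoly set \<Rightarrow> bool" where
  "homogeneous_ideal N I \<longleftrightarrow>
     ideal I (coord_ring N) \<and> I = genideal (coord_ring N) (I \<inter> (\<Union>d. forms N d))"

text \<open>The union of the ideal quotients of \<open>I\<close> by the powers of the irrelevant ideal: the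
  \<open>k\<close>-th power is generated by the forms of degree \<open>k\<close>. For homogeneous \<open>I\<close> defining a closed
  subscheme \<open>Z\<close>, the forms of degree \<open>d\<close> in the saturation are the global sections of the
  \<open>d\<close>-th twist of the ideal sheaf of \<open>Z\<close>.\<close>

definition saturation :: "nat \<Rightarrow> (nat, 'k::field) mpoly set \<Rightarrow> (nat, 'k) mpoly set" where
  "saturation N I = {p \<in> carrier (coord_ring N). \<exists>k. \<forall>q\<in>forms N k. q * p \<in> I}"

definition saturated_ideal :: "nat \<Rightarrow> (nat, 'k::field) mpoly set \<Rightarrow> bool" where
  "saturated_ideal N I \<longleftrightarrow> homogeneous_ideal N I \<and> saturation N I = I"


section \<open>Hilbert function, Hilbert series and dimension\<close>

text \<open>The dimension over \<open>k\<close> of the degree \<open>i\<close> part of \<open>R\<^sub>X = k[x\<^sub>0, \<dots>, x\<^sub>N]/I\<close>. Both \<open>k\<close> and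
  the graded piece are viewed inside the quotient ring, as images of the constants and of the forms
  of degree \<open>i\<close>.\<close>

definition hilbert_function :: "nat \<Rightarrow> (nat, 'k::field) mpoly set \<Rightarrow> nat \<Rightarrow> nat" where
  "hilbert_function N I i = ring.dim (coord_ring N Quot I)
     (a_r_coset (coord_ring N) I ` mpoly_consts) (a_r_coset (coord_ring N) I ` forms N i)"

definition hilbert_series :: "nat \<Rightarrow> (nat, 'k::field) mpoly set \<Rightarrow> rat fps" where
  "hilbert_series N I = Abs_fps (\<lambda>i. of_nat (hilbert_function N I i))"

definition is_hilbert_polynomial :: "nat \<Rightarrow> (nat, 'k::field) mpoly set \<Rightarrow> rat poly \<Rightarrow> bool" where
  "is_hilbert_polynomial N I P \<longleftrightarrow>
     (\<forall>\<^sub>F i in sequentially. of_nat (hilbert_function N I i) = poly P (of_nat i))"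

text \<open>The empty scheme has Hilbert polynomial \<open>0\<close>, whose degree is \<open>0\<close> by convention; hence the
  condition that \<open>P\<close> is nonzero.\<close>

definition has_dimension :: "nat \<Rightarrow> (nat, 'k::field) mpoly set \<Rightarrow> nat \<Rightarrow> bool" where
  "has_dimension N I n \<longleftrightarrow>
     (\<exists>P. is_hilbert_polynomial N I P \<and> P \<noteq> 0 \<and> Polynomial.degree P = n)"


section \<open>General linear subspaces\<close>

text \<open>An \<open>m\<close>-dimensional linear subspace of \<open>\<bbbP>\<^sup>N\<close> is cut out by \<open>N - m\<close> linearly independent
  linear forms; it is represented by the ideal these generate.\<close>

definition linear_equations :: "nat \<Rightarrow> nat \<Rightarrow> (nat, 'k::field) mpoly list set" where
  "linear_equations N m = {Ls. length Ls = N - m \<and> set Ls \<subseteq> forms N 1 \<and>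
     ring.independent (coord_ring N) mpoly_consts Ls}"

definition linear_subspaces :: "nat \<Rightarrow> nat \<Rightarrow> (nat, 'k::field) mpoly set set" where
  "linear_subspaces N m = (\<lambda>Ls. genideal (coord_ring N) (set Ls)) ` linear_equations N m"

definition coeff_matrix :: "(nat, 'k::field) mpoly list \<Rightarrow> nat \<times> nat \<Rightarrow> 'k" where
  "coeff_matrix Ls = (\<lambda>(r, j). Poly_Mapping.lookup (Ls ! r) (Poly_Mapping.single j 1))"

text \<open>The Zariski topology on the Grassmannian of \<open>m\<close>-dimensional linear subspaces is the quotient
  topology from the space of \<open>(N - m) \<times> (N + 1)\<close> coefficient matrices of full rank: \<open>U\<close> is open iff
  its preimage is the complement of the common zero set of some polynomials \<open>F\<close> in the matrix
  entries.\<close>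

definition zariski_open :: "nat \<Rightarrow> nat \<Rightarrow> (nat, 'k::field) mpoly set set \<Rightarrow> bool" where
  "zariski_open N m U \<longleftrightarrow> U \<subseteq> linear_subspaces N m \<and>
     (\<exists>F \<subseteq> carrier (mpoly_ring ({..<N - m} \<times> {..N})).
        \<forall>Ls\<in>linear_equations N m.
          genideal (coord_ring N) (set Ls) \<in> U \<longleftrightarrow> (\<exists>f\<in>F. mpoly_eval (coeff_matrix Ls) f \<noteq> 0))"

definition for_general_linear_subspace ::
    "nat \<Rightarrow> nat \<Rightarrow> ((nat, 'k::field) mpoly set \<Rightarrow> bool) \<Rightarrow> bool" where
  "for_general_linear_subspace N m Q \<longleftrightarrow> (\<exists>U. zariski_open N m U \<and> U \<noteq> {} \<and> (\<forall>L\<in>U. Q L))"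


section \<open>Condition ND\<close>

text \<open>For a linear subspace \<open>\<Lambda>\<close> with ideal \<open>L\<close>, the homogeneous coordinate ring of \<open>\<Lambda>\<close> is the
  polynomial ring \<open>k[x\<^sub>0, \<dots>, x\<^sub>N]/L\<close>, and the scheme \<open>X \<inter> \<Lambda>\<close> is defined by \<open>I\<^sub>X + L\<close>. The
  following is the space of degree \<open>k\<close> forms on \<open>\<Lambda>\<close> vanishing on \<open>X \<inter> \<Lambda>\<close>, that is, of global
  sections of the \<open>k\<close>-th twist of the ideal sheaf of \<open>X \<inter> \<Lambda>\<close> in \<open>\<Lambda>\<close>. Saturating before passing to the quotient is
  harmless since \<open>I\<^sub>X + L\<close> contains \<open>L\<close>.\<close>

definition section_ideal ::
    "nat \<Rightarrow> (nat, 'k::field) mpoly set \<Rightarrow> (nat, 'k) mpoly set \<Rightarrow> nat \<Rightarrow> (nat, 'k) mpoly set set" where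
  "section_ideal N I L k =
     a_r_coset (coord_ring N) L ` (saturation N (set_add (coord_ring N) I L) \<inter> forms N k)"

definition ND :: "nat \<Rightarrow> nat \<Rightarrow> (nat, 'k::field) mpoly set \<Rightarrow> nat \<Rightarrow> bool" where
  "ND N e I k \<longleftrightarrow> (\<forall>m. e \<le> m \<and> m \<le> N \<longrightarrow>
     for_general_linear_subspace N m
       (\<lambda>L. section_ideal N I L k = {zero (coord_ring N Quot L)}))"

end

theory Submission
  imports Defs
begin

text \<open>Put \<open>N = n + e\<close> and \<open>l = d + 1\<close>. For \<open>m = N\<close>, condition ND says that \<open>I\<close> contains no nonzero
  form of degree at most \<open>d\<close>. Hence in degrees up to \<open>l\<close> the Hilbert function of \<open>I\<close> is that of the
  polynomial ring, except that \<open>dim I\<^sub>l\<close> is subtracted in degree \<open>l\<close>, and multiplication of the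
  series by \<open>(1 - t)\<^bsup>n+1\<^esup>\<close> shows that \<open>h\<^sub>i\<close> is the number of monomials of degree \<open>i\<close> in \<open>e\<close>
  variables for \<open>i \<le> d\<close>, and that number minus \<open>dim I\<^sub>l\<close> for \<open>i = l\<close>.

  To bound \<open>dim I\<^sub>l\<close>, choose \<open>n + 1\<close> general linear forms. Each is a nonzerodivisor modulo the
  saturation of the sum of \<open>I\<close> and the ideal of its predecessors, so by condition ND no nonzero form of
  degree \<open>l\<close> in \<open>I\<close> lies in the ideal generated by all of them. Thus \<open>I\<^sub>l\<close> embeds into the forms of
  degree \<open>l\<close> in the \<open>e\<close> remaining variables.\<close>


subsection \<open>Polynomials as a vector space\<close>

text \<open>Scaling is multiplication by a constant polynomial, so it coincides with the action of
  \<open>mpoly_consts\<close> behind the ring-theoretic \<open>Span\<close> and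
  \<open>dimension\<close>.\<close>

definition pscale :: "'k::field \<Rightarrow> ('v, 'k) mpoly \<Rightarrow> ('v, 'k) mpoly" where
  "pscale c p = Poly_Mapping.single 0 c * p"

abbreviation monomial :: "('v \<Rightarrow>\<^sub>0 nat) \<Rightarrow> ('v, 'k::field) mpoly" where
  "monomial m \<equiv> Poly_Mapping.single m 1"

interpretation polys: vector_space "pscale :: 'k::field \<Rightarrow> ('v, 'k) mpoly \<Rightarrow> ('v, 'k) mpoly"
  by unfold_locales
    (simp_all add: pscale_def distrib_left distrib_right single_add mult_single mult.assoc [symmetric])

lemma lookup_pscale [simp]: "Poly_Mapping.lookup (pscale c p) m = c * Poly_Mapping.lookup p m"
  by (simp add: pscale_def mult_map_scale_conv_mult [symmetric] map.rep_eq when_def)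

lemma pscale_mult_left: "pscale c p * q = pscale c (p * q)"
  by (simp add: pscale_def mult.assoc)

lemma pscale_mult_right: "p * pscale c q = pscale c (p * q)"
  by (simp add: pscale_def mult.left_commute)

lemma subspace_keys: "polys.subspace {p :: ('v, 'k::field) mpoly. Poly_Mapping.keys p \<subseteq> M}"
  unfolding polys.subspace_def
  by (auto simp: in_keys_iff lookup_add) (metis add.right_neutral in_keys_iff subsetD)+

lemma mpoly_as_sum:
  fixes p :: "('v, 'k::field) mpoly"
  shows "p = (\<Sum>m\<in>Poly_Mapping.keys p. pscale (Poly_Mapping.lookup p m) (monomial m))"
  by (rule poly_mapping_eqI)
    (simp add: lookup_sum lookup_single when_def not_in_keys_iff_lookup_eq_zero if_distrib [of "(*) _"] cong: if_cong)

text \<open>Support conditions become spans, which makes the linear algebra of \<open>polys\<close>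
  available for forms.\<close>

lemma span_monomials:
  "polys.span (monomial ` M) = {p :: ('v, 'k::field) mpoly. Poly_Mapping.keys p \<subseteq> M}"
proof
  show "polys.span (monomial ` M) \<subseteq> {p :: ('v, 'k::field) mpoly. Poly_Mapping.keys p \<subseteq> M}"
    by (rule polys.span_minimal [OF _ subspace_keys]) auto
  show "{p :: ('v, 'k::field) mpoly. Poly_Mapping.keys p \<subseteq> M} \<subseteq> polys.span (monomial ` M)"
  proof
    fix p :: "('v, 'k::field) mpoly" assume p: "p \<in> {p. Poly_Mapping.keys p \<subseteq> M}"
    show "p \<in> polys.span (monomial ` M)"
    proof (subst mpoly_as_sum, rule polys.span_sum)
      fix m assume "m \<in> Poly_Mapping.keys p"
      with p have "(monomial m :: ('v, 'k) mpoly) \<in> monomial ` M" by blast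
      then show "pscale (Poly_Mapping.lookup p m) (monomial m) \<in> polys.span (monomial ` M)"
        by (intro polys.span_scale polys.span_base)
    qed
  qed
qed

lemma inj_monomial: "inj_on (monomial :: _ \<Rightarrow> ('v, 'k::field) mpoly) M"
  by (rule inj_onI, drule arg_cong [where f = Poly_Mapping.keys]) simp

lemma independent_monomials: "polys.independent ((monomial :: _ \<Rightarrow> ('v, 'k::field) mpoly) ` M)"
proof
  assume "polys.dependent ((monomial :: _ \<Rightarrow> ('v, 'k::field) mpoly) ` M)"
  then obtain m where m: "m \<in> M"
    "(monomial m :: ('v, 'k::field) mpoly) \<in> polys.span (monomial ` M - {monomial m})"
    unfolding polys.dependent_def by auto
  moreover have "monomial ` M - {monomial m :: ('v, 'k::field) mpoly} = monomial ` (M - {m})"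
    using inj_on_image_set_diff [OF inj_monomial [of M], of M "{m}"] m(1)
    by (metis Diff_subset empty_subsetI image_empty image_insert insert_subset)
  ultimately show False by (simp add: span_monomials)
qed

text \<open>Induction on \<open>B\<close>: if the new vector \<open>x\<close> is
  \<open>u + w\<close> with \<open>u\<close> in the span of \<open>B\<close> and \<open>w\<close> in
  that of \<open>C\<close>, then \<open>w = x - u\<close> lies in both spans of the hypothesis and
  vanishes, which puts \<open>x\<close> in the span of \<open>B\<close>.\<close>

lemma independent_union_of_disjoint_spans:
  fixes B C :: "('v, 'k::field) mpoly set"
  assumes "finite B" "polys.independent B" "polys.independent C" "polys.span B \<inter> polys.span C \<subseteq> {0}"
  shows "polys.independent (B \<union> C)"
  using assms
proof (induction B rule: finite_induct)
  case (insert x B)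
  have x: "x \<notin> polys.span B" "polys.independent B"
    using insert.prems(1) insert.hyps(2) by (simp_all add: polys.independent_insert)
  have "polys.span B \<inter> polys.span C \<subseteq> {0}"
    using insert.prems(3) polys.span_mono [of B "insert x B"] by blast
  then have "polys.independent (B \<union> C)" using insert x by blast
  moreover have "x \<notin> polys.span (B \<union> C)"
  proof
    assume "x \<in> polys.span (B \<union> C)"
    then obtain u w where uw: "u \<in> polys.span B" "w \<in> polys.span C" "x = u + w"
      by (auto simp: polys.span_Un)
    have "u \<in> polys.span (insert x B)" "x \<in> polys.span (insert x B)"
      using uw(1) polys.span_mono [of B "insert x B"] by (auto intro: polys.span_base)
    then have "x - u \<in> polys.span (insert x B)" by (rule polys.span_diff [rotated])
    then have "w = 0" using uw insert.prems(3) by auto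
    then show False using uw x by simp
  qed
  ultimately show ?case by (simp add: polys.independent_insertI)
qed simp


subsection \<open>Monomials and forms\<close>

definition mons :: "'v set \<Rightarrow> nat \<Rightarrow> ('v \<Rightarrow>\<^sub>0 nat) set" where
  "mons V i = {m. Poly_Mapping.keys m \<subseteq> V \<and> (\<Sum>v\<in>Poly_Mapping.keys m. Poly_Mapping.lookup m v) = i}"

abbreviation var :: "'v \<Rightarrow> ('v \<Rightarrow>\<^sub>0 nat)" where
  "var v \<equiv> Poly_Mapping.single v (Suc 0)"

lemma degree_monomial_add:
  fixes m m' :: "'v \<Rightarrow>\<^sub>0 nat"
  shows "(\<Sum>v\<in>Poly_Mapping.keys (m + m'). Poly_Mapping.lookup (m + m') v) =
    (\<Sum>v\<in>Poly_Mapping.keys m. Poly_Mapping.lookup m v) +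
    (\<Sum>v\<in>Poly_Mapping.keys m'. Poly_Mapping.lookup m' v)"
proof -
  have *: "(\<Sum>v\<in>Poly_Mapping.keys p. Poly_Mapping.lookup p v) =
      (\<Sum>v\<in>Poly_Mapping.keys m \<union> Poly_Mapping.keys m'. Poly_Mapping.lookup p v)"
    if "Poly_Mapping.keys p \<subseteq> Poly_Mapping.keys m \<union> Poly_Mapping.keys m'" for p :: "'v \<Rightarrow>\<^sub>0 nat"
    using that by (intro sum.mono_neutral_left) (auto simp: in_keys_iff)
  show ?thesis
    using * [of "m + m'"] * [of m] * [of m'] Poly_Mapping.keys_add [of m m']
    by (simp only: lookup_add sum.distrib Un_upper1 Un_upper2)
qed

lemma keys_monomial_add:
  "Poly_Mapping.keys (m + m') = Poly_Mapping.keys m \<union> Poly_Mapping.keys (m' :: 'v \<Rightarrow>\<^sub>0 nat)"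
  by (auto simp: in_keys_iff lookup_add)

lemma mons_add: "m \<in> mons V i \<Longrightarrow> m' \<in> mons V j \<Longrightarrow> m + m' \<in> mons V (i + j)"
  using degree_monomial_add [of m m'] by (auto simp: mons_def keys_monomial_add)

lemma var_in_mons [simp]: "var v \<in> mons V i \<longleftrightarrow> v \<in> V \<and> i = Suc 0"
  by (auto simp: mons_def)

lemma mons_0 [simp]: "mons V 0 = {0}"
  by (auto simp: mons_def in_keys_iff intro!: poly_mapping_eqI)

lemma mons_Suc_split:
  assumes "m \<in> mons V (Suc i)" "v \<in> Poly_Mapping.keys m"
  obtains m' where "m' \<in> mons V i" "m = var v + m'"
proof
  have *: "m = var v + (m - var v)"
    using assms(2) by (intro poly_mapping_eqI) (auto simp: lookup_add lookup_minus lookup_single when_def in_keys_iff)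
  then show "m = var v + (m - var v)" .
  then show "m - var v \<in> mons V i"
    using assms(1) degree_monomial_add [of "var v" "m - var v"] keys_monomial_add [of "var v" "m - var v"]
    by (auto simp: mons_def)
qed

lemma mons_Suc_nonempty_keys:
  assumes "m \<in> mons V (Suc i)" obtains v where "v \<in> Poly_Mapping.keys m" "v \<in> V"
proof -
  have "Poly_Mapping.keys m \<noteq> {}" using assms by (auto simp: mons_def)
  then obtain v where "v \<in> Poly_Mapping.keys m" by blast
  then show ?thesis using that assms by (auto simp: mons_def)
qed

lemma mons_split:
  assumes "m \<in> mons V (i + j)"
  obtains m1 m2 where "m1 \<in> mons V i" "m2 \<in> mons V j" "m = m1 + m2"
  using assms
proof (induction i arbitrary: m thesis)
  case 0
  show ?case by (rule "0.prems"(1)) (use "0.prems" in auto)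
next
  case (Suc i)
  obtain v where v: "v \<in> Poly_Mapping.keys m" "v \<in> V"
    by (rule mons_Suc_nonempty_keys [of m V "i + j"]) (use Suc.prems in auto)
  then obtain m' where m': "m' \<in> mons V (i + j)" "m = var v + m'"
    using mons_Suc_split [of m V "i + j" v] Suc.prems(2) by auto
  obtain m1 m2 where "m1 \<in> mons V i" "m2 \<in> mons V j" "m' = m1 + m2"
    using Suc.IH [OF _ m'(1)] by blast
  moreover from this(1) v have "var v + m1 \<in> mons V (Suc i)"
    using mons_add [of "var v" V "Suc 0" m1 i] by simp
  ultimately show ?case
    using Suc.prems(1) [of "var v + m1" m2] m' by (simp add: add.assoc)
qed

lemma mons_insert_Suc:
  assumes "v \<notin> V"
  shows "mons (insert v V) (Suc i) = mons V (Suc i) \<union> (+) (var v) ` mons (insert v V) i" (is "?l = ?r")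
proof
  show "?l \<subseteq> ?r"
  proof
    fix m assume m: "m \<in> ?l"
    show "m \<in> ?r"
    proof (cases "v \<in> Poly_Mapping.keys m")
      case True
      with m show ?thesis by (metis UnI2 imageI mons_Suc_split)
    next
      case False
      with m show ?thesis by (auto simp: mons_def)
    qed
  qed
  show "?r \<subseteq> ?l"
    using mons_add [of "var v" "insert v V" "Suc 0" _ i] by (auto simp: mons_def)
qed

lemma mons_empty_Suc [simp]: "mons {} (Suc i) = {}"
  by (auto simp: mons_def)

lemma finite_mons: "finite V \<Longrightarrow> finite (mons V i)"
proof (induction V arbitrary: i rule: finite_induct)
  case empty
  then show ?case by (cases i) auto
next
  case (insert v V)
  then show ?case by (induction i) (auto simp: mons_insert_Suc)
qed

lemma card_mons_insert_Suc:
  assumes "finite V" "v \<notin> V"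
  shows "card (mons (insert v V) (Suc i)) = card (mons V (Suc i)) + card (mons (insert v V) i)"
proof -
  have "mons V (Suc i) \<inter> (+) (var v) ` mons (insert v V) i = {}"
    using assms by (auto simp: mons_def keys_monomial_add)
  moreover have "inj_on ((+) (var v)) (mons (insert v V) i)" by (auto intro: inj_onI)
  ultimately show ?thesis
    using assms by (simp add: mons_insert_Suc card_Un_disjoint finite_mons card_image)
qed

text \<open>This is the Hilbert series of a polynomial ring. By the recursion
  \<open>card_mons_insert_Suc\<close>, multiplication by \<open>1 - fps_X\<close> removes one
  variable.\<close>

lemma card_mons_fps:
  assumes "finite V"
  shows "Abs_fps (\<lambda>i. of_nat (card (mons V i))) * (1 - fps_X) ^ card V = (1 :: 'a::field fps)"
  using assms
proof (induction V rule: finite_induct)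
  case empty
  have "Abs_fps (\<lambda>i. of_nat (card (mons {} i))) = (1 :: 'a fps)"
    by (rule fps_ext) (case_tac n, auto)
  then show ?case by simp
next
  case (insert v V)
  have "Abs_fps (\<lambda>i. of_nat (card (mons (insert v V) i))) * (1 - fps_X) =
     (Abs_fps (\<lambda>i. of_nat (card (mons V i))) :: 'a fps)"
  proof (rule fps_ext)
    fix i show "fps_nth (Abs_fps (\<lambda>i. of_nat (card (mons (insert v V) i))) * (1 - fps_X)) i =
     fps_nth (Abs_fps (\<lambda>i. of_nat (card (mons V i))) :: 'a fps) i"
      using insert.hyps by (cases i) (auto simp: ring_distribs card_mons_insert_Suc)
  qed
  then show ?case using insert by (simp add: mult.assoc [symmetric])
qed

text \<open>Both generating functions are inverse to the same power of \<open>1 - fps_X\<close>.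
  This serves to pass from whichever variables complete a basis to the first \<open>e\<close>
  ones.\<close>

lemma card_mons_cong:
  assumes "finite V" "finite W" "card V = card W"
  shows "card (mons V i) = card (mons W i)"
proof -
  let ?G = "\<lambda>V. Abs_fps (\<lambda>i. of_nat (card (mons V i))) :: rat fps"
  let ?u = "(1 - fps_X) ^ card W :: rat fps"
  have "?G V * ?u = 1" "?G W * ?u = 1"
    using card_mons_fps [OF assms(1), where 'a = rat] card_mons_fps [OF assms(2), where 'a = rat] assms(3)
    by simp_all
  then have "?G V * ?u = ?G W * ?u" "?u \<noteq> 0" by auto
  then have "?G V = ?G W" using mult_right_cancel by blast
  then have "fps_nth (?G V) i = fps_nth (?G W) i" by (rule arg_cong)
  then show ?thesis by simp
qed

section \<open>Forms as spans of monomials\<close>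

lemma carrier_mpoly_ring: "p \<in> carrier (mpoly_ring V) \<longleftrightarrow> (\<forall>m\<in>Poly_Mapping.keys p. Poly_Mapping.keys m \<subseteq> V)"
  by (simp add: mpoly_ring_def)

lemma forms_keys: "forms N i = {p. Poly_Mapping.keys p \<subseteq> mons {..N} i}"
  by (auto simp: forms_def carrier_mpoly_ring mons_def)

lemma forms_span: "forms N i = polys.span (monomial ` mons {..N} i)"
  by (simp add: span_monomials forms_keys)

lemma subspace_forms: "polys.subspace (forms N i)"
  by (simp add: forms_span polys.subspace_span)

lemma monomial_in_forms [simp]: "monomial m \<in> forms N i \<longleftrightarrow> m \<in> mons {..N} i"
  by (simp add: forms_keys)

lemma forms_carrier: "p \<in> forms N i \<Longrightarrow> p \<in> carrier (coord_ring N)"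
  by (simp add: forms_def)

lemma forms_mult: "p \<in> forms N i \<Longrightarrow> q \<in> forms N j \<Longrightarrow> p * q \<in> forms N (i + j)"
  using Poly_Mapping.keys_mult [of p q] mons_add by (fastforce simp: forms_keys)

subsection \<open>The coordinate ring and its quotients\<close>

lemma mpoly_ring_simps [simp]:
  "mult (mpoly_ring V) = (*)" "one (mpoly_ring V) = 1" "zero (mpoly_ring V) = 0" "add (mpoly_ring V) = (+)"
  by (simp_all add: mpoly_ring_def)

lemma carrier_mpoly_add: "p \<in> carrier (mpoly_ring V) \<Longrightarrow> q \<in> carrier (mpoly_ring V) \<Longrightarrow> p + q \<in> carrier (mpoly_ring V)"
  using Poly_Mapping.keys_add [of p q] by (auto simp: carrier_mpoly_ring)

lemma carrier_mpoly_mult: "p \<in> carrier (mpoly_ring V) \<Longrightarrow> q \<in> carrier (mpoly_ring V) \<Longrightarrow> p * q \<in> carrier (mpoly_ring V)"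
  using Poly_Mapping.keys_mult [of p q] by (fastforce simp: carrier_mpoly_ring keys_monomial_add)

lemma keys_uminus: "Poly_Mapping.keys (- p :: ('v, 'k::field) mpoly) = Poly_Mapping.keys p"
  by (auto simp: in_keys_iff)

lemma carrier_mpoly_const: "Poly_Mapping.single 0 c \<in> carrier (mpoly_ring V)"
  by (simp add: carrier_mpoly_ring)

text \<open>The carrier \<open>A\<close> is left open so as to cover both the polynomial ring in
  \<open>V\<close> and its field of constants.\<close>

lemma cring_mpoly_carrier:
  fixes A :: "('v, 'k::field) mpoly set"
  assumes "0 \<in> A" "1 \<in> A" "\<And>p q. p \<in> A \<Longrightarrow> q \<in> A \<Longrightarrow> p + q \<in> A"
    "\<And>p q. p \<in> A \<Longrightarrow> q \<in> A \<Longrightarrow> p * q \<in> A" "\<And>p. p \<in> A \<Longrightarrow> - p \<in> A"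
  shows "cring (mpoly_ring V\<lparr>carrier := A\<rparr>)"
proof (rule cringI)
  show "abelian_group (mpoly_ring V\<lparr>carrier := A\<rparr>)"
    by (rule abelian_groupI) (auto simp: assms add.assoc add.commute intro!: bexI [OF _ assms(5)])
  show "comm_monoid (mpoly_ring V\<lparr>carrier := A\<rparr>)"
    by (rule comm_monoidI) (simp_all add: assms mult.assoc mult.commute)
qed (simp add: distrib_right)

lemma cring_mpoly_ring: "cring (mpoly_ring V :: ('v, 'k::field) mpoly ring)"
proof -
  have "cring ((mpoly_ring V :: ('v, 'k) mpoly ring)\<lparr>carrier := carrier (mpoly_ring V :: ('v, 'k) mpoly ring)\<rparr>)"
    by (rule cring_mpoly_carrier)
      (simp_all add: carrier_mpoly_add carrier_mpoly_mult, simp_all add: carrier_mpoly_ring keys_uminus)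
  then show ?thesis by simp
qed

lemma ring_mpoly_ring: "ring (mpoly_ring V :: ('v, 'k::field) mpoly ring)"
  using cring_mpoly_ring by (rule cring.axioms)

lemma subfield_mpoly_consts: "subfield mpoly_consts (mpoly_ring V :: ('v, 'k::field) mpoly ring)"
proof (rule ring.subfield_iff(1) [OF ring_mpoly_ring])
  have "cring ((mpoly_ring V :: ('v, 'k) mpoly ring)\<lparr>carrier := mpoly_consts\<rparr>)"
    by (rule cring_mpoly_carrier)
      (auto simp: mpoly_consts_def mult_single image_iff simp flip: single_one single_add single_uminus
        intro: exI [of _ 0])
  then show "field ((mpoly_ring V :: ('v, 'k) mpoly ring)\<lparr>carrier := mpoly_consts\<rparr>)"
  proof (rule cring.cring_fieldI)
    show "Units ((mpoly_ring V :: ('v, 'k) mpoly ring)\<lparr>carrier := mpoly_consts\<rparr>) =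
        carrier ((mpoly_ring V :: ('v, 'k) mpoly ring)\<lparr>carrier := mpoly_consts\<rparr>) -
        {\<zero>\<^bsub>(mpoly_ring V :: ('v, 'k) mpoly ring)\<lparr>carrier := mpoly_consts\<rparr>\<^esub>}"
    proof (intro equalityI subsetI)
      fix p assume "p \<in> carrier ((mpoly_ring V :: ('v, 'k) mpoly ring)\<lparr>carrier := mpoly_consts\<rparr>) -
        {\<zero>\<^bsub>(mpoly_ring V :: ('v, 'k) mpoly ring)\<lparr>carrier := mpoly_consts\<rparr>\<^esub>}"
      then obtain c where c: "p = Poly_Mapping.single 0 c" "c \<noteq> 0"
        by (auto simp: mpoly_consts_def) (metis single_zero)
      then have "Poly_Mapping.single 0 (inverse c) * p = 1" "p * Poly_Mapping.single 0 (inverse c) = 1"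
        by (simp_all add: mult_single)
      then show "p \<in> Units ((mpoly_ring V :: ('v, 'k) mpoly ring)\<lparr>carrier := mpoly_consts\<rparr>)"
        using c by (auto simp: Units_def mpoly_consts_def)
    qed (auto simp: Units_def)
  qed
qed (auto simp: mpoly_consts_def carrier_mpoly_const)

section \<open>Agreement of the two notions of span, independence and dimension\<close>

text \<open>Both spans grow by one generator at a time, so induction along the list matches
  \<open>line_extension\<close> with \<open>polys.span_insert\<close>.\<close>

lemma Span_mpoly:
  fixes ps :: "('v, 'k::field) mpoly list"
  shows "ring.Span (mpoly_ring V) mpoly_consts ps = polys.span (set ps)"
proof -
  interpret ring "mpoly_ring V :: ('v, 'k) mpoly ring" by (rule ring_mpoly_ring)
  show ?thesis
  proof (induction ps)
    case (Cons p ps)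
    have "q \<in> line_extension mpoly_consts p (polys.span (set ps)) \<longleftrightarrow> (\<exists>c. q - pscale c p \<in> polys.span (set ps))"
      for q
    proof -
      have "q \<in> line_extension mpoly_consts p (polys.span (set ps)) \<longleftrightarrow>
          (\<exists>c. \<exists>r\<in>polys.span (set ps). q = pscale c p + r)"
        by (simp add: line_extension_mem_iff mpoly_consts_def pscale_def)
      also have "\<dots> \<longleftrightarrow> (\<exists>c. q - pscale c p \<in> polys.span (set ps))"
        by (intro iff_exI) (auto simp: eq_diff_eq' intro!: bexI [of _ "q - pscale _ p"])
      finally show ?thesis .
    qed
    then show ?case
      using Cons by (auto simp: polys.span_insert)
  qed simp
qed

lemma independent_mpoly:
  fixes ps :: "('v, 'k::field) mpoly list"
  assumes "distinct ps" "polys.independent (set ps)" "set ps \<subseteq> carrier (mpoly_ring V)"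
  shows "ring.independent (mpoly_ring V) mpoly_consts ps"
proof -
  interpret ring "mpoly_ring V :: ('v, 'k) mpoly ring" by (rule ring_mpoly_ring)
  show ?thesis
    using assms
  proof (induction ps)
    case (Cons p ps)
    then have "p \<notin> polys.span (set ps)" "polys.independent (set ps)"
      by (simp_all add: polys.independent_insert)
    with Cons show ?case
      by (intro li_Cons) (auto simp: Span_mpoly simp del: Span.simps)
  qed auto
qed

lemma dimension_mpoly:
  fixes B :: "('v, 'k::field) mpoly set"
  assumes "finite B" "polys.independent B" "B \<subseteq> carrier (mpoly_ring V)"
  shows "ring.dimension (mpoly_ring V) (card B) mpoly_consts (polys.span B)"
proof -
  interpret ring "mpoly_ring V :: ('v, 'k) mpoly ring" by (rule ring_mpoly_ring)
  obtain ps where ps: "set ps = B" "distinct ps"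
    using finite_distinct_list assms(1) by blast
  then show ?thesis
    using dimension_independent [OF independent_mpoly [of ps V]] assms distinct_card [OF ps(2)]
    by (simp add: Span_mpoly del: Span.simps)
qed

section \<open>Homogeneous pieces of an ideal and the Hilbert function\<close>

context
  fixes N :: nat and I :: "(nat, 'k::field) mpoly set"
  assumes ideal: "ideal I (coord_ring N)"
begin

lemma ideal_carrier: "p \<in> I \<Longrightarrow> p \<in> carrier (coord_ring N)"
  by (rule ideal.Icarr [OF ideal])

lemma ideal_mult: "p \<in> carrier (coord_ring N) \<Longrightarrow> q \<in> I \<Longrightarrow> p * q \<in> I"
  using ideal.I_l_closed [OF ideal, of q p] by simp

lemma ideal_add: "p \<in> I \<Longrightarrow> q \<in> I \<Longrightarrow> p + q \<in> I"
  using additive_subgroup.a_closed [OF ideal.axioms(1) [OF ideal], of p q] by simp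

lemma subspace_ideal: "polys.subspace I"
  unfolding polys.subspace_def
  using additive_subgroup.zero_closed [OF ideal.axioms(1) [OF ideal]] ideal_add ideal_mult [OF carrier_mpoly_const]
  by (simp add: pscale_def)

lemma ideal_dim_le_card_mons: "polys.dim (I \<inter> forms N i) \<le> card (mons {..N} i)"
proof -
  have "polys.dim (I \<inter> forms N i) \<le> card ((monomial :: _ \<Rightarrow> (nat, 'k) mpoly) ` mons {..N} i)"
    by (rule polys.dim_le_card) (auto simp: forms_span finite_mons)
  also have "\<dots> \<le> card (mons {..N} i)"
    by (simp add: card_image_le finite_mons)
  finally show ?thesis .
qed

text \<open>Rank-nullity for the quotient map restricted to the forms of degree \<open>i\<close>,
  whose kernel is \<open>I \<inter> forms N i\<close>. Since \<open>1\<close> is outside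
  \<open>I\<close>, the quotient ring is nontrivial and the image of the constants is a
  field.\<close>

lemma hilbert_function_eq:
  assumes "1 \<notin> I"
  shows "hilbert_function N I i = card (mons {..N} i) - polys.dim (I \<inter> forms N i)"
proof -
  let ?R = "coord_ring N :: (nat, 'k) mpoly ring"
  let ?h = "a_r_coset ?R I"
  interpret hom: ring_hom_ring ?R "?R Quot I" ?h
    by (rule ideal.rcos_ring_hom_ring [OF ideal])
  have ker: "?h p = zero (?R Quot I) \<longleftrightarrow> p \<in> I" if "p \<in> carrier ?R" for p
    using that ideal.rcos_const_imp_mem [OF ideal that] hom.R.a_rcos_zero [OF ideal]
    by (auto simp: FactRing_def)
  have "?h 1 \<noteq> zero (?R Quot I)"
    using ker [of 1] assms by (simp add: carrier_mpoly_ring)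
  then have one_zero: "one (?R Quot I) \<noteq> zero (?R Quot I)"
    by (simp add: FactRing_def)
  have "hom.R.dimension (card ((monomial :: _ \<Rightarrow> (nat, 'k) mpoly) ` mons {..N} i)) mpoly_consts (forms N i)"
    unfolding forms_span
    by (rule dimension_mpoly) (simp_all add: finite_mons independent_monomials, auto simp: carrier_mpoly_ring mons_def)
  then have 1: "hom.R.dimension (card (mons {..N} i)) mpoly_consts (forms N i :: (nat, 'k) mpoly set)"
    by (simp add: card_image [OF inj_monomial])
  obtain B where B: "B \<subseteq> I \<inter> forms N i" "polys.independent B" "I \<inter> forms N i \<subseteq> polys.span B"
      "card B = polys.dim (I \<inter> forms N i)"
    by (rule polys.basis_exists)
  have "B \<subseteq> polys.span (monomial ` mons {..N} i)"
    using B(1) by (auto simp: forms_span)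
  then have "finite B"
    by (rule polys.independent_span_bound [OF _ B(2), THEN conjunct1, rotated]) (simp add: finite_mons)
  moreover have "polys.span B = I \<inter> forms N i"
    using polys.span_minimal [OF B(1) polys.subspace_inter [OF subspace_ideal subspace_forms]] B(3)
    by (rule equalityI)
  moreover have "a_kernel (?R\<lparr>carrier := forms N i\<rparr>) (?R Quot I) ?h = I \<inter> forms N i"
    unfolding a_kernel_def' using ker [OF forms_carrier, of _ i] by (simp add: Int_def conj_commute cong: conj_cong)
  ultimately have 2: "hom.R.dimension (polys.dim (I \<inter> forms N i)) mpoly_consts
      (a_kernel (?R\<lparr>carrier := forms N i\<rparr>) (?R Quot I) ?h)"
    using dimension_mpoly [of B "{..N}"] B ideal_carrier by auto
  show ?thesis
    using hom.S.dimI [OF hom.img_is_subfield(2) [OF subfield_mpoly_consts one_zero]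
        hom.rank_nullity_theorem [OF subfield_mpoly_consts one_zero 1 2]]
    by (simp add: hilbert_function_def over_def)
qed

end

subsection \<open>Polynomial curves of linear forms\<close>

definition lagrange_poly :: "'a::field set \<Rightarrow> 'a \<Rightarrow> 'a poly" where
  "lagrange_poly A a = Polynomial.smult (inverse (\<Prod>b\<in>A - {a}. a - b)) (\<Prod>b\<in>A - {a}. [:- b, 1:])"

lemma poly_lagrange_poly:
  assumes "finite A" "a \<in> A" "x \<in> A"
  shows "poly (lagrange_poly A a) x = (if x = a then 1 else 0)"
proof (cases "x = a")
  case True
  have "(\<Prod>b\<in>A - {a}. a - b) \<noteq> 0"
    using assms by simp
  then show ?thesis
    using True by (simp add: lagrange_poly_def poly_prod)
next
  case False
  then have "(\<Prod>b\<in>A - {a}. x - b) = 0"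
    using assms by auto
  then show ?thesis
    using False by (simp add: lagrange_poly_def poly_prod)
qed

lemma degree_lagrange_poly:
  assumes "finite A" "a \<in> A"
  shows "Polynomial.degree (lagrange_poly A a) < card A"
proof -
  have "Polynomial.degree (\<Prod>b\<in>A - {a}. [:- b, 1:]) \<le> (\<Sum>b\<in>A - {a}. Polynomial.degree [:- b, 1:])"
    using degree_prod_sum_le [of "A - {a}" "\<lambda>b. [:- b, 1:]"] assms by (simp add: o_def)
  also have "\<dots> < card A"
    using card_Diff1_less [OF assms] by simp
  finally show ?thesis
    using degree_smult_le [of "inverse (\<Prod>b\<in>A - {a}. a - b)"] unfolding lagrange_poly_def
    by (meson order.strict_trans1)
qed

lemma degree_lagrange_sum:
  assumes "finite A" "A \<noteq> {}"
  shows "Polynomial.degree (\<Sum>a\<in>A. Polynomial.smult (u a) (lagrange_poly A a)) < card A"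
proof -
  have "Polynomial.degree (\<Sum>a\<in>A. Polynomial.smult (u a) (lagrange_poly A a)) \<le> card A - 1"
  proof (rule degree_sum_le [OF assms(1)])
    fix a assume "a \<in> A"
    then show "Polynomial.degree (Polynomial.smult (u a) (lagrange_poly A a)) \<le> card A - 1"
      using degree_lagrange_poly [OF assms(1), of a] degree_smult_le [of "u a" "lagrange_poly A a"] by linarith
  qed
  then show ?thesis using assms by (metis card_gt_0_iff Suc_pred' le_imp_less_Suc)
qed

lemma poly_lagrange_sum:
  assumes "finite A" "x \<in> A"
  shows "poly (\<Sum>a\<in>A. Polynomial.smult (u a) (lagrange_poly A a)) x = u x"
proof -
  have "poly (\<Sum>a\<in>A. Polynomial.smult (u a) (lagrange_poly A a)) x = (\<Sum>a\<in>A. if a = x then u x else 0)"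
    unfolding poly_sum poly_smult by (intro sum.cong) (use assms in \<open>auto simp: poly_lagrange_poly\<close>)
  then show ?thesis using assms by simp
qed

text \<open>Lagrange interpolation: both sides have degree below \<open>card A\<close> and agree on
  \<open>A\<close>. The weights at \<open>s\<close> depend on \<open>A\<close> alone, so they serve
  all coefficients of a curve at once.\<close>

lemma poly_eq_lagrange:
  assumes "finite A" "Polynomial.degree p < card A"
  shows "poly p s = (\<Sum>a\<in>A. poly p a * poly (lagrange_poly A a) s)"
proof -
  have "A \<noteq> {}" using assms by auto
  then have "p = (\<Sum>a\<in>A. Polynomial.smult (poly p a) (lagrange_poly A a))"
    using assms degree_lagrange_sum poly_lagrange_sum by (intro poly_eqI_degree [of A]) (simp_all add: poly_lagrange_sum)
  then have "poly p s = poly (\<Sum>a\<in>A. Polynomial.smult (poly p a) (lagrange_poly A a)) s"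
    by simp
  then show ?thesis by (simp only: poly_sum poly_smult)
qed

text \<open>A one-parameter polynomial family of linear forms. General choices are made along such a
  curve, where it suffices to avoid finitely many parameters.\<close>

definition curve :: "nat \<Rightarrow> (nat \<Rightarrow> 'k::field poly) \<Rightarrow> 'k \<Rightarrow> (nat, 'k) mpoly" where
  "curve N c t = (\<Sum>v\<le>N. pscale (poly (c v) t) (monomial (var v)))"

lemma curve_in_forms: "curve N c t \<in> forms N 1"
  unfolding curve_def by (intro polys.subspace_sum [OF subspace_forms] polys.subspace_scale [OF subspace_forms]) simp

lemma var_eq_iff [simp]: "var v = var w \<longleftrightarrow> v = w"
  by (auto dest!: arg_cong [where f = "\<lambda>m. Poly_Mapping.lookup m v"] simp: lookup_single when_def split: if_splits)

lemma lookup_curve: "v \<le> N \<Longrightarrow> Poly_Mapping.lookup (curve N c t) (var v) = poly (c v) t"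
  by (simp add: curve_def lookup_sum lookup_single when_def var_eq_iff if_distrib [of "(*) _"] cong: if_cong)

text \<open>By interpolation, every point of the curve is a linear combination of finitely many
  points with parameters in \<open>T\<close>.\<close>

lemma curve_mult_mem:
  fixes c :: "nat \<Rightarrow> 'k::field poly"
  assumes "polys.subspace J" "infinite T" "\<And>t. t \<in> T \<Longrightarrow> curve N c t * q \<in> J"
  shows "curve N c s * q \<in> J"
proof -
  \<comment> \<open>\<open>D\<close> bounds the degrees of all coefficient polynomials, so
    \<open>Suc D\<close> nodes are enough for all of them.\<close>
  define D where "D = Max ((\<lambda>v. Polynomial.degree (c v)) ` {..N})"
  obtain A where A: "A \<subseteq> T" "finite A" "card A = Suc D"
    using infinite_arbitrarily_large [OF assms(2)] by metis
  have "Polynomial.degree (c v) < card A" if "v \<le> N" for v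
    using that unfolding A D_def by (intro le_imp_less_Suc Max_ge) auto
  then have "curve N c s = (\<Sum>v\<le>N. pscale (\<Sum>a\<in>A. poly (c v) a * poly (lagrange_poly A a) s) (monomial (var v)))"
    unfolding curve_def using poly_eq_lagrange [OF A(2)] by (intro sum.cong) auto
  also have "\<dots> = (\<Sum>v\<le>N. \<Sum>a\<in>A. pscale (poly (lagrange_poly A a) s) (pscale (poly (c v) a) (monomial (var v))))"
    by (simp add: polys.scale_sum_left mult.commute)
  also have "\<dots> = (\<Sum>a\<in>A. pscale (poly (lagrange_poly A a) s) (curve N c a))"
    unfolding curve_def by (subst sum.swap) (simp add: polys.scale_sum_right)
  finally have "curve N c s * q = (\<Sum>a\<in>A. pscale (poly (lagrange_poly A a) s) (curve N c a * q))"
    by (simp only: sum_distrib_right pscale_mult_left)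
  also have "\<dots> \<in> J"
    using assms A by (intro polys.subspace_sum polys.subspace_scale) auto
  finally show ?thesis .
qed

lemma mons_1: "mons V (Suc 0) = var ` V"
proof (intro equalityI subsetI)
  fix m assume m: "m \<in> mons V (Suc 0)"
  obtain v where v: "v \<in> Poly_Mapping.keys m" "v \<in> V"
    using m by (rule mons_Suc_nonempty_keys)
  obtain m' where "m' \<in> mons V 0" "m = var v + m'"
    using m v(1) by (rule mons_Suc_split)
  then show "m \<in> var ` V" using v by simp
qed auto

lemma linear_form_eq:
  assumes "w \<in> forms N 1"
  shows "w = (\<Sum>v\<le>N. pscale (Poly_Mapping.lookup w (var v)) (monomial (var v)))"
proof -
  have "inj_on var {..N}"
    by (auto intro!: inj_onI)
  have "w = (\<Sum>m\<in>var ` {..N}. pscale (Poly_Mapping.lookup w m) (monomial m))"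
    by (subst mpoly_as_sum [of w], rule sum.mono_neutral_left)
      (use assms in \<open>auto simp: forms_keys mons_1 in_keys_iff\<close>)
  also have "\<dots> = (\<Sum>v\<le>N. pscale (Poly_Mapping.lookup w (var v)) (monomial (var v)))"
    by (subst sum.reindex [OF \<open>inj_on var {..N}\<close>]) simp
  finally show ?thesis .
qed

text \<open>The coefficients of the given forms are interpolated at distinct parameters;
  characteristic 0 makes the field infinite, so there are enough of these.\<close>

lemma curve_through:
  fixes W :: "(nat, 'k::{field, ring_char_0}) mpoly set"
  assumes "finite W" "W \<subseteq> forms N 1"
  shows "\<exists>c s. \<forall>w\<in>W. curve N c (s w) = w"
proof -
  obtain A :: "'k set" where "finite A" "card A = card W"
    using infinite_arbitrarily_large [OF infinite_UNIV_char_0] by metis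
  then obtain s where s: "bij_betw s W A"
    using finite_same_card_bij assms(1) by metis
  define c where "c v = (\<Sum>a\<in>A. Polynomial.smult (Poly_Mapping.lookup (the_inv_into W s a) (var v)) (lagrange_poly A a))" for v
  have "curve N c (s w) = w" if "w \<in> W" for w
  proof -
    have "s w \<in> A" using that s by (auto simp: bij_betw_def)
    then have "poly (c v) (s w) = Poly_Mapping.lookup w (var v)" for v
      unfolding c_def using s that \<open>finite A\<close> by (subst poly_lagrange_sum) (auto simp: bij_betw_def the_inv_into_f_f)
    then show ?thesis
      using linear_form_eq [of w N] that assms(2) by (auto simp: curve_def)
  qed
  then show ?thesis by blast
qed


subsection \<open>Saturation and general nonzerodivisors\<close>

text \<open>An infinite family of zerodivisors \<open>y t\<close>, each killing some \<open>p t\<close> in a fixed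
  finite-dimensional space, is thinned to one whose \<open>p t\<close> span a space of minimal dimension. Then any
  finite product of the \<open>y s\<close> whose \<open>p s\<close> are independent kills all the \<open>p t\<close>: this is clear when the
  \<open>p s\<close> already span, and factors are removed one at a time because by minimality infinitely many
  different factors are available. The empty product gives the contradiction.\<close>

lemma finite_zero_divisors:
  fixes y :: "'k::field \<Rightarrow> ('v, 'k) mpoly" and J W :: "('v, 'k) mpoly set"
  assumes J: "polys.subspace J"
    and mult: "\<And>t p. p \<in> J \<Longrightarrow> y t * p \<in> J"
    and kill: "\<And>T q. infinite T \<Longrightarrow> q \<in> C \<Longrightarrow> (\<And>t. t \<in> T \<Longrightarrow> y t * q \<in> J) \<Longrightarrow> q \<in> J"
    and C: "W \<subseteq> C" "\<And>t p. p \<in> C \<Longrightarrow> y t * p \<in> C"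
    and W: "finite B0" "W \<subseteq> polys.span B0"
  shows "finite {t. \<exists>p\<in>W. p \<notin> J \<and> y t * p \<in> J}"
proof (rule ccontr)
  define Bad where "Bad = {t. \<exists>p\<in>W. p \<notin> J \<and> y t * p \<in> J}"
  assume "infinite {t. \<exists>p\<in>W. p \<notin> J \<and> y t * p \<in> J}"
  then have inf: "infinite Bad" by (simp add: Bad_def)
  have "\<forall>t. \<exists>p. t \<in> Bad \<longrightarrow> p \<in> W \<and> p \<notin> J \<and> y t * p \<in> J"
    by (auto simp: Bad_def)
  then obtain p where "\<forall>t. t \<in> Bad \<longrightarrow> p t \<in> W \<and> p t \<notin> J \<and> y t * p t \<in> J"
    by metis
  then have p: "p t \<in> W" "p t \<notin> J" "y t * p t \<in> J" if "t \<in> Bad" for t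
    using that by auto
  define Q where "Q r \<longleftrightarrow> (\<exists>T B. infinite T \<and> T \<subseteq> Bad \<and> finite B \<and> card B = r \<and> p ` T \<subseteq> polys.span B)" for r
  have "Q (card B0)"
    unfolding Q_def using inf W p by blast
  define r where "r = (LEAST r. Q r)"
  have "Q r" unfolding r_def using \<open>Q (card B0)\<close> by (rule LeastI)
  have r_le: "r \<le> r'" if "Q r'" for r'
    unfolding r_def using that by (rule Least_le)
  obtain T B where T: "infinite T" "T \<subseteq> Bad" and B: "finite B" "card B = r" "p ` T \<subseteq> polys.span B"
    using \<open>Q r\<close> unfolding Q_def by auto
  have claim: "(\<Prod>s\<in>A. y s) * p t \<in> J"
    if "A \<subseteq> T" "finite A" "inj_on p A" "polys.independent (p ` A)" "t \<in> T" for A t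
    using that
  \<comment> \<open>The measure counts the factors that may still be added; \<open>bound\<close>
    shows that it drops strictly.\<close>
  proof (induction "r - card A" arbitrary: A t rule: less_induct)
    case less
    let ?F = "\<Prod>s\<in>A. y s"
    show ?case
    proof (cases "p ` T \<subseteq> polys.span (p ` A)")
      case True
      have "?F * x \<in> J" if "x \<in> polys.span (p ` A)" for x
        using that
      proof (induction rule: polys.span_induct)
        show "polys.subspace {x. ?F * x \<in> J}"
          using J by (auto simp: polys.subspace_def distrib_left pscale_mult_right)
      next
        fix x assume "x \<in> p ` A"
        then obtain s where s: "s \<in> A" "x = p s" by auto
        have "?F * x = (\<Prod>s\<in>A - {s}. y s) * (y s * p s)"
          using less.prems(2) s by (simp add: prod.remove mult_ac)
        moreover have "(\<Prod>s\<in>A'. y s) * q \<in> J" if "finite A'" "q \<in> J" for A' q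
          using that by (induction A' rule: finite_induct) (auto simp: mult.assoc mult)
        ultimately show "?F * x \<in> J"
          using p(3) [of s] s less.prems T(2) by auto
      qed
      then show ?thesis using True less.prems by blast
    next
      case False
      define T1 where "T1 = {t\<in>T. p t \<in> polys.span (p ` A)}"
      have ext: "inj_on p (insert t' A)" "polys.independent (p ` insert t' A)" "t' \<notin> A"
        if "t' \<in> T" "t' \<notin> T1" for t'
      proof -
        have t': "p t' \<notin> polys.span (p ` A)" using that by (simp add: T1_def)
        then have "p t' \<notin> p ` A" using polys.span_base [of "p t'" "p ` A"] by auto
        then show "inj_on p (insert t' A)" "t' \<notin> A"
          using less.prems(3) by (simp_all only: inj_on_insert) blast+
        show "polys.independent (p ` insert t' A)"
          using less.prems(4) t' by (simp add: polys.independent_insertI)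
      qed
      have bound: "Suc (card A) \<le> r" if "t' \<in> T" "t' \<notin> T1" for t'
      proof -
        have "card (p ` insert t' A) \<le> card B"
          using polys.independent_span_bound [OF B(1) ext(2) [OF that]] B(3) less.prems(1) that by auto
        then show ?thesis
          using card_image [OF ext(1) [OF that]] ext(3) [OF that] less.prems(2) B(2) by simp
      qed
      obtain t0 where t0: "t0 \<in> T" "t0 \<notin> T1" using False by (auto simp: T1_def)
      \<comment> \<open>Otherwise the parameters in \<open>T1\<close> would satisfy \<open>Q\<close>
        with only \<open>card A < r\<close> spanning vectors.\<close>
      have "finite T1"
      proof (rule ccontr)
        assume "infinite T1"
        then have "Q (card (p ` A))"
          unfolding Q_def using T(2) less.prems(2) by (intro exI [of _ T1] exI [of _ "p ` A"]) (auto simp: T1_def)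
        then have "r \<le> card A"
          using r_le [of "card (p ` A)"] card_image [OF less.prems(3)] by simp
        with bound [OF t0] show False by simp
      qed
      then have infT: "infinite (T - T1)" using T(1) by (simp add: Diff_infinite_finite)
      have FC: "?F * p t \<in> C"
      proof -
        have "p t \<in> C" using p(1) less.prems(5) T(2) C(1) by auto
        moreover have "(\<Prod>s\<in>A'. y s) * q \<in> C" if "finite A'" "q \<in> C" for A' q
          using that by (induction A' rule: finite_induct) (auto simp: mult.assoc C(2))
        ultimately show ?thesis using less.prems(2) by blast
      qed
      show ?thesis
      \<comment> \<open>For each \<open>t'\<close> outside \<open>T1\<close> the product enlarged by
        \<open>y t'\<close> falls under the induction hypothesis, so infinitely many
        \<open>y t'\<close> carry \<open>?F * p t\<close> into \<open>J\<close>.\<close>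
      proof (rule kill [OF infT FC])
        fix t' assume t': "t' \<in> T - T1"
        then have *: "t' \<in> T" "t' \<notin> T1" by auto
        have "(\<Prod>s\<in>insert t' A. y s) * p t \<in> J"
          by (rule less.hyps)
            (use ext [OF *] bound [OF *] less.prems * in auto)
        then show "y t' * (?F * p t) \<in> J"
          using ext(3) [OF *] less.prems(2) by (simp add: mult.assoc)
      qed
    qed
  qed
  obtain t where "t \<in> T" using infinite_imp_nonempty [OF T(1)] by blast
  have "(\<Prod>s\<in>{}. y s) * p t \<in> J"
    by (rule claim) (use \<open>t \<in> T\<close> polys.independent_empty in auto)
  then show False using p(2) [of t] \<open>t \<in> T\<close> T(2) by auto
qed

section \<open>The saturation of an ideal, and zerodivisors modulo it\<close>

context
  fixes N :: nat and J :: "(nat, 'k::field) mpoly set"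
  assumes ideal: "ideal J (coord_ring N)"
begin

text \<open>The condition on \<open>q\<close> is linear, so it can be tested on the monomials
  spanning the forms of degree \<open>k\<close>.\<close>

lemma saturation_iff:
  "p \<in> saturation N J \<longleftrightarrow> p \<in> carrier (coord_ring N) \<and> (\<exists>k. \<forall>m\<in>mons {..N} k. monomial m * p \<in> J)"
proof -
  have "(\<forall>q\<in>forms N k. q * p \<in> J) \<longleftrightarrow> (\<forall>m\<in>mons {..N} k. monomial m * p \<in> J)" for k
  proof
    assume *: "\<forall>m\<in>mons {..N} k. monomial m * p \<in> J"
    show "\<forall>q\<in>forms N k. q * p \<in> J"
    proof
      fix q :: "(nat, 'k) mpoly" assume "q \<in> forms N k"
      then have "q \<in> polys.span (monomial ` mons {..N} k)" by (simp add: forms_span)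
      then show "q * p \<in> J"
      proof (induction rule: polys.span_induct)
        show "polys.subspace {q. q * p \<in> J}"
          using subspace_ideal [OF ideal] by (auto simp: polys.subspace_def distrib_right pscale_mult_left)
      qed (use * in auto)
    qed
  qed auto
  then show ?thesis by (simp add: saturation_def)
qed

lemma saturation_exponent_mono:
  assumes "\<forall>m\<in>mons {..N} k. monomial m * p \<in> J" "m \<in> mons {..N} (j + k)"
  shows "monomial m * p \<in> J"
proof -
  obtain m1 m2 where m: "m1 \<in> mons {..N} j" "m2 \<in> mons {..N} k" "m = m1 + m2"
    using assms(2) by (rule mons_split)
  then have "(monomial m1 :: (nat, 'k) mpoly) \<in> carrier (coord_ring N)"
    by (intro forms_carrier [of _ N j]) simp
  then have "monomial m1 * (monomial m2 * p) \<in> J"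
    by (rule ideal_mult [OF ideal]) (use m assms in auto)
  then show ?thesis
    using m by (simp add: mult.assoc [symmetric] mult_single)
qed

lemma subspace_saturation: "polys.subspace (saturation N J)"
proof -
  note J = subspace_ideal [OF ideal]
  have "p + q \<in> saturation N J" if pq: "p \<in> saturation N J" "q \<in> saturation N J" for p q
  proof -
    obtain k1 k2 where "\<forall>m\<in>mons {..N} k1. monomial m * p \<in> J" "\<forall>m\<in>mons {..N} k2. monomial m * q \<in> J"
      using pq by (auto simp: saturation_iff)
    then have "\<forall>m\<in>mons {..N} (k1 + k2). monomial m * p \<in> J" "\<forall>m\<in>mons {..N} (k1 + k2). monomial m * q \<in> J"
      using saturation_exponent_mono [of k1 p _ k2] saturation_exponent_mono [of k2 q _ k1] by (auto simp: add.commute)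
    then have "\<forall>m\<in>mons {..N} (k1 + k2). monomial m * (p + q) \<in> J"
      using polys.subspace_add [OF J] by (simp add: distrib_left)
    then show ?thesis
      using pq carrier_mpoly_add unfolding saturation_iff by blast
  qed
  moreover have "pscale c p \<in> saturation N J" if "p \<in> saturation N J" for c p
    using that carrier_mpoly_mult [OF carrier_mpoly_const, of p "{..N}" c] polys.subspace_scale [OF J]
    unfolding saturation_iff pscale_mult_right by (metis pscale_def)
  moreover have "0 \<in> saturation N J"
    using polys.subspace_0 [OF J] by (simp add: saturation_iff carrier_mpoly_ring)
  ultimately show ?thesis unfolding polys.subspace_def by blast
qed

lemma saturation_mult:
  assumes "q \<in> carrier (coord_ring N)" "p \<in> saturation N J"
  shows "q * p \<in> saturation N J"
proof -
  obtain k where "\<forall>m\<in>mons {..N} k. monomial m * p \<in> J"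
    using assms(2) by (auto simp: saturation_iff)
  then have "\<forall>m\<in>mons {..N} k. monomial m * (q * p) \<in> J"
    using ideal_mult [OF ideal assms(1)] by (metis mult.left_commute)
  then show ?thesis using assms carrier_mpoly_mult by (auto simp: saturation_iff)
qed

lemma ideal_subset_saturation: "J \<subseteq> saturation N J"
  using ideal_carrier [OF ideal] by (auto simp: saturation_iff intro!: exI [of _ 0])

text \<open>With \<open>K\<close> the largest exponent needed for any variable, a monomial of degree
  \<open>Suc K\<close> gives up one variable \<open>v\<close> and still leaves degree
  \<open>K\<close> to carry \<open>monomial (var v) * q\<close> into \<open>J\<close>.\<close>

lemma saturation_vars:
  assumes q: "q \<in> carrier (coord_ring N)" and vars: "\<And>v. v \<le> N \<Longrightarrow> monomial (var v) * q \<in> saturation N J"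
  shows "q \<in> saturation N J"
proof -
  have "\<exists>k. \<forall>m\<in>mons {..N} k. monomial m * (monomial (var v) * q) \<in> J" if "v \<le> N" for v
    using vars [OF that] by (simp add: saturation_iff)
  then obtain k where k: "\<And>v m. v \<le> N \<Longrightarrow> m \<in> mons {..N} (k v) \<Longrightarrow> monomial m * (monomial (var v) * q) \<in> J"
    by metis
  define K where "K = Max (k ` {..N})"
  have "monomial m * q \<in> J" if m: "m \<in> mons {..N} (Suc K)" for m
  proof -
    obtain v where v: "v \<in> Poly_Mapping.keys m" "v \<in> {..N}"
      using m by (rule mons_Suc_nonempty_keys)
    obtain m' where m': "m' \<in> mons {..N} K" "m = var v + m'"
      using m v(1) by (rule mons_Suc_split)
    have "k v \<le> K" unfolding K_def using v by (intro Max_ge) auto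
    then have "m' \<in> mons {..N} ((K - k v) + k v)" using m' by simp
    then have "monomial m' * (monomial (var v) * q) \<in> J"
      using saturation_exponent_mono [of "k v" "monomial (var v) * q"] k v by blast
    then show ?thesis
      using m' by (simp add: mult.assoc [symmetric] mult_single add.commute)
  qed
  then show ?thesis using q by (auto simp: saturation_iff)
qed

text \<open>This takes the place of avoiding associated primes. If infinitely many points of the
  curve carry \<open>q\<close> into the saturation, then all points do by
  \<open>curve_mult_mem\<close>, in particular all variables, and \<open>q\<close> lies there by
  \<open>saturation_vars\<close>.\<close>

lemma finite_zero_divisors_on_curve:
  assumes "\<And>v. v \<le> N \<Longrightarrow> \<exists>s. curve N c s = monomial (var v)"
  shows "finite {t. \<exists>p\<in>forms N d. p \<notin> saturation N J \<and> curve N c t * p \<in> J}"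
proof -
  have curve_carrier: "curve N c t \<in> carrier (coord_ring N)" for t
    by (rule forms_carrier [OF curve_in_forms])
  have "finite {t. \<exists>p\<in>forms N d. p \<notin> saturation N J \<and> curve N c t * p \<in> saturation N J}"
  proof (rule finite_zero_divisors [where C = "carrier (coord_ring N)" and ?B0.0 = "monomial ` mons {..N} d"])
    show "polys.subspace (saturation N J)" by (rule subspace_saturation)
    show "curve N c t * p \<in> saturation N J" if "p \<in> saturation N J" for t p
      using that by (rule saturation_mult [OF curve_carrier])
    show "q \<in> saturation N J" if "infinite T" "q \<in> carrier (coord_ring N)"
      "\<And>t. t \<in> T \<Longrightarrow> curve N c t * q \<in> saturation N J" for T q
    proof (rule saturation_vars [OF that(2)])
      fix v assume "v \<le> N"
      then obtain s where "curve N c s = monomial (var v)" using assms by blast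
      then show "monomial (var v) * q \<in> saturation N J"
        using curve_mult_mem [OF subspace_saturation that(1,3), of s] by simp
    qed
    show "curve N c t * p \<in> carrier (coord_ring N)" if "p \<in> carrier (coord_ring N)" for t p
      using that by (rule carrier_mpoly_mult [OF curve_carrier])
  qed (auto simp: forms_carrier forms_span [symmetric] finite_mons)
  then show ?thesis
    by (rule rev_finite_subset) (use ideal_subset_saturation in auto)
qed

end

subsection \<open>The degree pieces of an ideal generated by linear forms\<close>

lemma ideal_mpolyI:
  fixes A :: "('v, 'k::field) mpoly set"
  assumes "A \<subseteq> carrier (mpoly_ring V)" "0 \<in> A" "\<And>p q. p \<in> A \<Longrightarrow> q \<in> A \<Longrightarrow> p + q \<in> A"
    and mult: "\<And>p q. p \<in> carrier (mpoly_ring V) \<Longrightarrow> q \<in> A \<Longrightarrow> p * q \<in> A"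
  shows "ideal A (mpoly_ring V)"
proof -
  interpret ring "mpoly_ring V :: ('v, 'k) mpoly ring" by (rule ring_mpoly_ring)
  have neg: "- p \<in> A" if "p \<in> A" for p
  proof -
    have "Poly_Mapping.single 0 (- 1) * p \<in> A"
      by (rule mult [OF carrier_mpoly_const that])
    moreover have "Poly_Mapping.single 0 (- 1) * p = - p"
      by (simp add: single_uminus)
    ultimately show ?thesis by simp
  qed
  show ?thesis
  proof (rule idealI [OF ring_mpoly_ring])
    show "subgroup A (add_monoid (mpoly_ring V))"
    proof (rule add.subgroupI)
      fix p assume p: "p \<in> A"
      then have "\<ominus>\<^bsub>mpoly_ring V\<^esub> p = - p"
        using assms(1) neg [OF p] p by (intro minus_equality) auto
      then show "\<ominus>\<^bsub>mpoly_ring V\<^esub> p \<in> A" using neg [OF p] by simp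
    qed (use assms in auto)
  next
    fix a x assume "a \<in> A" "x \<in> carrier (mpoly_ring V :: ('v, 'k) mpoly ring)"
    then show "x \<otimes>\<^bsub>mpoly_ring V\<^esub> a \<in> A" "a \<otimes>\<^bsub>mpoly_ring V\<^esub> x \<in> A"
      using mult [of x a] by (simp_all add: mult.commute)
  qed
qed

section \<open>Homogeneous parts of polynomials\<close>

text \<open>Restricting to the keys of \<open>p\<close> keeps the sum finite, while
  \<open>mons UNIV i\<close> avoids any reference to \<open>N\<close>.\<close>

definition homogeneous_part :: "nat \<Rightarrow> ('v, 'k::field) mpoly \<Rightarrow> ('v, 'k) mpoly" where
  "homogeneous_part i p =
     (\<Sum>m\<in>Poly_Mapping.keys p \<inter> mons UNIV i. pscale (Poly_Mapping.lookup p m) (monomial m))"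

lemma lookup_homogeneous_part:
  "Poly_Mapping.lookup (homogeneous_part i p) m = (if m \<in> mons UNIV i then Poly_Mapping.lookup p m else 0)"
  by (auto simp: homogeneous_part_def lookup_sum lookup_single when_def not_in_keys_iff_lookup_eq_zero
      if_distrib [of "(*) _"] cong: if_cong)

lemma homogeneous_part_add: "homogeneous_part i (p + q) = homogeneous_part i p + homogeneous_part i q"
  by (rule poly_mapping_eqI) (simp add: lookup_homogeneous_part lookup_add)

lemma homogeneous_part_pscale: "homogeneous_part i (pscale c p) = pscale c (homogeneous_part i p)"
  by (rule poly_mapping_eqI) (simp add: lookup_homogeneous_part)

lemma homogeneous_part_0 [simp]: "homogeneous_part i 0 = 0"
  by (rule poly_mapping_eqI) (simp add: lookup_homogeneous_part)

lemma homogeneous_part_monomial: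
  "homogeneous_part i (monomial m) = (if m \<in> mons UNIV i then monomial m else 0)"
  by (rule poly_mapping_eqI) (simp add: lookup_homogeneous_part lookup_single when_def)

lemma homogeneous_part_forms: "p \<in> forms N i \<Longrightarrow> homogeneous_part i p = p"
  by (rule poly_mapping_eqI)
    (auto simp: lookup_homogeneous_part forms_keys mons_def in_keys_iff subset_iff)

lemma homogeneous_part_in_forms:
  assumes "p \<in> carrier (coord_ring N)"
  shows "homogeneous_part i p \<in> forms N i"
  using assms unfolding forms_keys carrier_mpoly_ring
  by (auto simp: in_keys_iff lookup_homogeneous_part mons_def split: if_splits)

text \<open>Both sides are bilinear in \<open>y\<close> and \<open>q\<close>, which reduces the
  claim to monomials, where degrees add.\<close>

lemma homogeneous_part_mult_linear:
  fixes y :: "(nat, 'k::field) mpoly"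
  assumes "y \<in> forms N 1"
  shows "homogeneous_part (Suc i) (y * q) = y * homogeneous_part i q"
proof -
  have mm: "homogeneous_part (Suc i) (monomial m * q) = monomial m * homogeneous_part i q"
    if m: "m \<in> mons {..N} 1" for m and q :: "(nat, 'k) mpoly"
  proof -
    have "q \<in> polys.span (monomial ` UNIV)" by (simp add: span_monomials)
    then show ?thesis
    proof (induction rule: polys.span_induct)
      show "polys.subspace {q. homogeneous_part (Suc i) (monomial m * q) = monomial m * homogeneous_part i q}"
        by (auto simp: polys.subspace_def homogeneous_part_add homogeneous_part_pscale distrib_left pscale_mult_right)
    next
      fix q :: "(nat, 'k) mpoly" assume "q \<in> monomial ` UNIV"
      then obtain m' where m': "q = monomial m'" by auto
      have "m + m' \<in> mons UNIV (Suc i) \<longleftrightarrow> m' \<in> mons UNIV i"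
        using m degree_monomial_add [of m m'] by (simp add: mons_def)
      then show "homogeneous_part (Suc i) (monomial m * q) = monomial m * homogeneous_part i q"
        by (simp add: m' mult_single homogeneous_part_monomial)
    qed
  qed
  have "y \<in> polys.span (monomial ` mons {..N} 1)" using assms by (simp add: forms_span)
  then show ?thesis
  proof (induction rule: polys.span_induct)
    show "polys.subspace {y. homogeneous_part (Suc i) (y * q) = y * homogeneous_part i q}"
      by (auto simp: polys.subspace_def homogeneous_part_add homogeneous_part_pscale distrib_right pscale_mult_left)
  qed (use mm in auto)
qed

text \<open>For linear forms \<open>Y\<close> this is the part of degree \<open>Suc d\<close> of the
  ideal they generate; \<open>d\<close> is the degree of the cofactors.\<close>

definition degree_piece :: "nat \<Rightarrow> nat \<Rightarrow> (nat, 'k::field) mpoly set \<Rightarrow> (nat, 'k) mpoly set" where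
  "degree_piece N d Y = polys.span {y * q |y q. y \<in> Y \<and> q \<in> forms N d}"

lemma degree_piece_base: "y \<in> Y \<Longrightarrow> q \<in> forms N d \<Longrightarrow> y * q \<in> degree_piece N d Y"
  unfolding degree_piece_def by (intro polys.span_base) blast

lemma degree_piece_subset_forms:
  assumes "Y \<subseteq> forms N 1"
  shows "degree_piece N d Y \<subseteq> forms N (Suc d)"
  unfolding degree_piece_def
  using assms forms_mult [of _ N 1 _ d] by (intro polys.span_minimal subspace_forms) auto

text \<open>The polynomials all of whose multiples have their part of degree \<open>Suc d\<close> in
  the piece form an ideal \<open>?E\<close> containing \<open>Y\<close>, hence also
  \<open>f\<close>. The multiple by \<open>1\<close> gives the claim.\<close>

lemma genideal_degree_piece:
  fixes f :: "(nat, 'k::field) mpoly"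
  assumes Y: "Y \<subseteq> forms N 1" and f: "f \<in> genideal (coord_ring N) Y" "f \<in> forms N (Suc d)"
  shows "f \<in> degree_piece N d Y"
proof -
  let ?R = "coord_ring N :: (nat, 'k) mpoly ring"
  let ?E = "{p \<in> carrier ?R. \<forall>q\<in>carrier ?R. homogeneous_part (Suc d) (q * p) \<in> degree_piece N d Y}"
  have sub: "polys.subspace (degree_piece N d Y)"
    by (simp add: degree_piece_def polys.subspace_span)
  interpret ring ?R by (rule ring_mpoly_ring)
  have "ideal ?E ?R"
  proof (rule ideal_mpolyI)
    fix p q assume "p \<in> carrier ?R" "q \<in> ?E"
    then show "p * q \<in> ?E"
      using carrier_mpoly_mult by (auto simp: mult.assoc [symmetric])
  qed (use sub in \<open>auto simp: polys.subspace_0 polys.subspace_add distrib_left homogeneous_part_add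
        carrier_mpoly_add carrier_mpoly_ring [of 0]\<close>)
  moreover have "Y \<subseteq> ?E"
  proof
    fix y assume y: "y \<in> Y"
    have "homogeneous_part (Suc d) (q * y) \<in> degree_piece N d Y" if "q \<in> carrier ?R" for q
    proof -
      have "y * homogeneous_part d q \<in> degree_piece N d Y"
        unfolding degree_piece_def using y homogeneous_part_in_forms [OF that] by (intro polys.span_base) auto
      then show ?thesis
        using homogeneous_part_mult_linear [of y N d q] y Y by (auto simp: mult.commute)
    qed
    then show "y \<in> ?E" using y Y forms_carrier by blast
  qed
  ultimately have "f \<in> ?E"
    using genideal_minimal f(1) by blast
  then have "homogeneous_part (Suc d) (1 * f) \<in> degree_piece N d Y"
    using carrier_mpoly_ring [of 1] by force
  then show ?thesis using homogeneous_part_forms [OF f(2)] by simp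
qed

lemma degree_piece_mult:
  assumes "p \<in> degree_piece N d Y" "x \<in> forms N 1"
  shows "x * p \<in> degree_piece N (Suc d) Y"
  using assms(1) unfolding degree_piece_def
proof (induction rule: polys.span_induct)
  show "polys.subspace {p. x * p \<in> polys.span {y * q |y q. y \<in> Y \<and> q \<in> forms N (Suc d)}}"
    using polys.subspace_span [of "{y * q |y q. y \<in> Y \<and> q \<in> forms N (Suc d)}"]
    by (auto simp: polys.subspace_def distrib_left pscale_mult_right)
next
  fix p assume "p \<in> {y * q |y q. y \<in> Y \<and> q \<in> forms N d}"
  then obtain y q where yq: "p = y * q" "y \<in> Y" "q \<in> forms N d" by blast
  then have "x * q \<in> forms N (Suc d)" using forms_mult [OF assms(2), of q d] by simp
  then show "x * p \<in> polys.span {y * q |y q. y \<in> Y \<and> q \<in> forms N (Suc d)}"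
    unfolding yq(1) mult.left_commute [of x] using yq(2) by (intro polys.span_base) blast
qed

text \<open>Modulo \<open>Y\<close> every linear form reduces to the variables in \<open>V\<close>.
  Induction on the degree splits one variable off a monomial, reduces the remaining factor, and then
  reduces that variable.\<close>

lemma forms_subset_degree_piece:
  assumes Y: "Y \<subseteq> forms N 1" and V: "V \<subseteq> {..N}"
    and span: "forms N 1 \<subseteq> polys.span (Y \<union> (\<lambda>v. monomial (var v)) ` V)"
  shows "forms N (Suc d) \<subseteq> polys.span (degree_piece N d Y \<union> monomial ` mons V (Suc d))"
proof (induction d)
  case 0
  have "Y \<subseteq> degree_piece N 0 Y"
  proof
    fix y assume "y \<in> Y"
    moreover have "1 \<in> forms N 0" by (simp add: forms_keys)
    ultimately have "y * 1 \<in> degree_piece N 0 Y" by (rule degree_piece_base)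
    then show "y \<in> degree_piece N 0 Y" by simp
  qed
  then have "Y \<union> (\<lambda>v. monomial (var v)) ` V \<subseteq> degree_piece N 0 Y \<union> monomial ` mons V (Suc 0)"
    by (auto simp: mons_1)
  from order_trans [OF span polys.span_mono [OF this]] show ?case by simp
next
  case (Suc d)
  let ?S = "polys.span (degree_piece N (Suc d) Y \<union> monomial ` mons V (Suc (Suc d)))"
  have lin: "x * monomial m \<in> ?S" if "x \<in> forms N 1" "m \<in> mons V (Suc d)" for x m
  proof -
    have "x \<in> polys.span (Y \<union> (\<lambda>v. monomial (var v)) ` V)" using that span by auto
    then show ?thesis
    proof (induction rule: polys.span_induct)
      show "polys.subspace {x. x * monomial m \<in> ?S}"
        using polys.subspace_span [of "degree_piece N (Suc d) Y \<union> monomial ` mons V (Suc (Suc d))"]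
        by (auto simp: polys.subspace_def distrib_right pscale_mult_left)
    next
      fix x :: "(nat, 'a) mpoly" assume "x \<in> Y \<union> (\<lambda>v. monomial (var v)) ` V"
      then consider "x \<in> Y" | v where "v \<in> V" "x = monomial (var v)" by blast
      then show "x * monomial m \<in> ?S"
      proof cases
        case 1
        have "m \<in> mons {..N} (Suc d)" using that(2) V by (auto simp: mons_def)
        then have "x * monomial m \<in> degree_piece N (Suc d) Y"
          by (intro degree_piece_base 1) simp
        then show ?thesis by (intro polys.span_base) simp
      next
        case 2
        then have "var v + m \<in> mons V (Suc (Suc d))"
          using mons_add [of "var v" V "Suc 0" m "Suc d"] that(2) by simp
        then show ?thesis
          unfolding 2(2) mult_single by (intro polys.span_base) simp
      qed
    qed
  qed
  have step: "x * p \<in> ?S" if x: "x \<in> forms N 1" and p: "p \<in> forms N (Suc d)" for x p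
  proof -
    have "p \<in> polys.span (degree_piece N d Y \<union> monomial ` mons V (Suc d))" using p Suc.IH by auto
    then show ?thesis
    proof (induction rule: polys.span_induct)
      show "polys.subspace {p. x * p \<in> ?S}"
        using polys.subspace_span [of "degree_piece N (Suc d) Y \<union> monomial ` mons V (Suc (Suc d))"]
        by (auto simp: polys.subspace_def distrib_left pscale_mult_right)
    next
      fix p :: "(nat, 'a) mpoly" assume "p \<in> degree_piece N d Y \<union> monomial ` mons V (Suc d)"
      then consider "p \<in> degree_piece N d Y" | m where "m \<in> mons V (Suc d)" "p = monomial m" by blast
      then show "x * p \<in> ?S"
      proof cases
        case 1
        then show ?thesis
          using degree_piece_mult [OF 1 x] by (intro polys.span_base) simp
      next
        case 2
        then show ?thesis using lin [OF x] by simp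
      qed
    qed
  qed
  show ?case
    unfolding forms_span [of N "Suc (Suc d)"]
  proof (rule polys.span_minimal [OF _ polys.subspace_span], rule image_subsetI)
    fix m :: "nat \<Rightarrow>\<^sub>0 nat" assume m: "m \<in> mons {..N} (Suc (Suc d))"
    obtain v where v: "v \<in> Poly_Mapping.keys m" "v \<in> {..N}"
      using m by (rule mons_Suc_nonempty_keys)
    obtain m' where m': "m' \<in> mons {..N} (Suc d)" "m = var v + m'"
      using m v(1) by (rule mons_Suc_split)
    have "monomial (var v) * monomial m' \<in> ?S"
      using v m' by (intro step) simp_all
    then show "monomial m \<in> ?S" by (simp add: m' mult_single)
  qed
qed

text \<open>The multiples of \<open>y\<close> by forms of degree \<open>d\<close> already form a
  subspace, so one cofactor \<open>g\<close> collects all of them.\<close>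

lemma degree_piece_insert:
  assumes "f \<in> degree_piece N d (insert y Y)"
  obtains g f' where "g \<in> forms N d" "f' \<in> degree_piece N d Y" "f = y * g + f'"
proof -
  have "{x * q |x q. x \<in> insert y Y \<and> q \<in> forms N d} =
      {y * q |q. q \<in> forms N d} \<union> {x * q |x q. x \<in> Y \<and> q \<in> forms N d}"
    by auto
  then obtain a f' where a: "a \<in> polys.span {y * q |q. q \<in> forms N d}" "f' \<in> degree_piece N d Y" "f = a + f'"
    using assms by (auto simp: degree_piece_def polys.span_Un)
  have "polys.subspace {y * q |q. q \<in> forms N d}"
    unfolding polys.subspace_def
  proof (intro conjI allI ballI)
    show "0 \<in> {y * q |q. q \<in> forms N d}"
      using polys.subspace_0 [OF subspace_forms] by force
    show "a + b \<in> {y * q |q. q \<in> forms N d}" if "a \<in> {y * q |q. q \<in> forms N d}" "b \<in> {y * q |q. q \<in> forms N d}" for a b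
      using that
    proof (elim CollectE exE conjE)
      fix q r assume "a = y * q" "q \<in> forms N d" "b = y * r" "r \<in> forms N d"
      then show ?thesis
        using polys.subspace_add [OF subspace_forms, of q N d r] by (auto simp: distrib_left [symmetric])
    qed
    show "pscale c a \<in> {y * q |q. q \<in> forms N d}" if "a \<in> {y * q |q. q \<in> forms N d}" for a c
      using that
    proof (elim CollectE exE conjE)
      fix q assume "a = y * q" "q \<in> forms N d"
      then show ?thesis
        using polys.subspace_scale [OF subspace_forms, of q N d c] by (auto simp: pscale_mult_right [symmetric])
    qed
  qed
  then have "a \<in> {y * q |q. q \<in> forms N d}"
    using a(1) by (simp add: polys.span_eq_iff [THEN iffD2])
  then show ?thesis using a that by blast
qed

text \<open>Basis extension completes \<open>Y\<close> to a basis of the linear forms by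
  \<open>e\<close> variables \<open>V\<close>. Bases \<open>b\<close> of the piece of
  \<open>I\<close> and \<open>c\<close> of the degree piece are jointly independent and lie in the
  span of \<open>c\<close> and the monomials in \<open>V\<close>; \<open>card c\<close> cancels from
  the resulting inequality.\<close>

lemma dim_le_card_mons:
  fixes I :: "(nat, 'k::field) mpoly set"
  assumes I: "polys.subspace I" and Y: "Y \<subseteq> forms N 1" "polys.independent Y" "finite Y"
    and card: "card Y + e = Suc N" and triv: "I \<inter> degree_piece N d Y \<subseteq> {0}"
  shows "polys.dim (I \<inter> forms N (Suc d)) \<le> card (mons {..<e} (Suc d))"
proof -
  let ?X = "(\<lambda>v. monomial (var v)) ` {..N} :: (nat, 'k) mpoly set"
  have X: "?X = monomial ` mons {..N} 1" by (auto simp: mons_1)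
  have indep_X: "polys.independent ?X" unfolding X by (rule independent_monomials)
  have span_X: "polys.span ?X = forms N 1" unfolding X by (rule forms_span [symmetric])
  have inj: "inj_on (\<lambda>v. monomial (var v) :: (nat, 'k) mpoly) S" for S
    by (rule inj_onI) (use inj_onD [OF inj_monomial [of UNIV]] in \<open>metis UNIV_I var_eq_iff\<close>)
  obtain B where B: "Y \<subseteq> B" "B \<subseteq> Y \<union> ?X" "polys.independent B" "Y \<union> ?X \<subseteq> polys.span B"
    using polys.maximal_independent_subset_extend [of Y "Y \<union> ?X"] Y(2) by auto
  have "finite B" by (rule finite_subset [OF B(2)]) (simp add: Y(3))
  have "B \<subseteq> polys.span ?X"
    using B(2) Y(1) polys.span_superset [of ?X] by (auto simp: span_X)
  then have "card B \<le> card ?X" using polys.independent_span_bound [OF _ B(3)] by blast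
  moreover have "card ?X \<le> card B"
    using polys.independent_span_bound [OF \<open>finite B\<close> indep_X] B(4) by blast
  ultimately have card_B: "card B = Suc N" by (simp add: card_image [OF inj])
  define V where "V = {v \<in> {..N}. monomial (var v) \<in> B - Y}"
  have BV: "B = Y \<union> (\<lambda>v. monomial (var v)) ` V"
    using B(1,2) by (auto simp: V_def)
  have "card V = card (B - Y)"
  proof -
    have "(\<lambda>v. monomial (var v)) ` V = B - Y" using B(2) by (auto simp: V_def)
    then show ?thesis using card_image [OF inj [of V]] by simp
  qed
  then have card_V: "card V = e"
    using card_Diff_subset [OF Y(3) B(1)] card_B card by simp
  have "finite V" by (simp add: V_def)
  have "forms N 1 \<subseteq> polys.span B"
    unfolding span_X [symmetric] using B(4) by (intro polys.span_minimal polys.subspace_span) auto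
  then have span: "forms N (Suc d) \<subseteq> polys.span (degree_piece N d Y \<union> monomial ` mons V (Suc d))"
    using Y(1) unfolding BV by (intro forms_subset_degree_piece) (auto simp: V_def)
  obtain b where b: "b \<subseteq> I \<inter> forms N (Suc d)" "polys.independent b" "card b = polys.dim (I \<inter> forms N (Suc d))"
    by (rule polys.basis_exists)
  obtain c where c: "c \<subseteq> degree_piece N d Y" "polys.independent c" "degree_piece N d Y \<subseteq> polys.span c"
    by (rule polys.basis_exists)
  have fin: "finite x" if "x \<subseteq> forms N (Suc d)" "polys.independent x" for x :: "(nat, 'k) mpoly set"
    using polys.independent_span_bound [of "monomial ` mons {..N} (Suc d)" x] that
    by (simp add: forms_span [symmetric] finite_mons)
  have c_forms: "c \<subseteq> forms N (Suc d)" using c(1) degree_piece_subset_forms [OF Y(1)] by blast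
  have "finite b" "finite c" using fin b c c_forms by auto
  have "polys.span b \<subseteq> I" using b(1) I by (intro polys.span_minimal) auto
  moreover have "polys.span c \<subseteq> degree_piece N d Y"
    using c(1) unfolding degree_piece_def by (intro polys.span_minimal polys.subspace_span)
  ultimately have spans: "polys.span b \<inter> polys.span c \<subseteq> {0}" using triv by blast
  then have "polys.independent (b \<union> c)"
    using b(2) c(2) \<open>finite b\<close> by (intro independent_union_of_disjoint_spans)
  moreover have "b \<union> c \<subseteq> polys.span (c \<union> monomial ` mons V (Suc d))"
  proof -
    have "degree_piece N d Y \<union> monomial ` mons V (Suc d) \<subseteq> polys.span (c \<union> monomial ` mons V (Suc d))"
      using c(3) polys.span_mono [of c "c \<union> monomial ` mons V (Suc d)"]
        polys.span_superset [of "c \<union> monomial ` mons V (Suc d)"] by blast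
    then have "polys.span (degree_piece N d Y \<union> monomial ` mons V (Suc d)) \<subseteq> polys.span (c \<union> monomial ` mons V (Suc d))"
      by (intro polys.span_minimal polys.subspace_span)
    then show ?thesis using span b(1) c_forms by blast
  qed
  ultimately have "card (b \<union> c) \<le> card (c \<union> monomial ` mons V (Suc d) :: (nat, 'k) mpoly set)"
    using polys.independent_span_bound \<open>finite c\<close> finite_mons [OF \<open>finite V\<close>] by (meson finite_UnI finite_imageI)
  also have "\<dots> \<le> card c + card (mons V (Suc d))"
    by (rule order_trans [OF card_Un_le]) (simp add: card_image_le finite_mons \<open>finite V\<close>)
  finally have "card (b \<union> c) \<le> card c + card (mons V (Suc d))" .
  moreover have "b \<inter> c = {}"
  proof -
    have "0 \<notin> b" using b(2) polys.dependent_zero by blast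
    then show ?thesis using spans polys.span_superset [of b] polys.span_superset [of c] by blast
  qed
  ultimately have "card b \<le> card (mons V (Suc d))"
    using card_Un_disjoint [OF \<open>finite b\<close> \<open>finite c\<close>] by simp
  moreover have "card (mons V (Suc d)) = card (mons {..<e} (Suc d))"
    by (rule card_mons_cong) (simp_all add: \<open>finite V\<close> card_V)
  ultimately show ?thesis using b(3) by simp
qed


subsection \<open>Generic choice\<close>

lemma mpoly_eval_cong:
  assumes "f \<in> carrier (mpoly_ring V)" "\<And>v. v \<in> V \<Longrightarrow> a v = b v"
  shows "mpoly_eval a f = mpoly_eval b f"
  unfolding mpoly_eval_def
proof (intro sum.cong refl arg_cong2 [where f = "(*)"] prod.cong)
  fix m v assume "m \<in> Poly_Mapping.keys f" "v \<in> Poly_Mapping.keys m"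
  then have "v \<in> V" using assms(1) by (auto simp: carrier_mpoly_ring)
  then show "a v ^ Poly_Mapping.lookup m v = b v ^ Poly_Mapping.lookup m v" by (simp add: assms(2))
qed

lemma mpoly_eval_poly:
  obtains P where "\<And>t. mpoly_eval (\<lambda>v. poly (g v) t) f = poly P t"
proof
  show "mpoly_eval (\<lambda>v. poly (g v) t) f =
      poly (\<Sum>m\<in>Poly_Mapping.keys f. [:Poly_Mapping.lookup f m:] *
        (\<Prod>v\<in>Poly_Mapping.keys m. g v ^ Poly_Mapping.lookup m v)) t" for t
    by (simp add: mpoly_eval_def poly_sum poly_prod poly_mult poly_power)
qed

text \<open>Only the row with index \<open>length bs\<close> moves with \<open>t\<close>, and its
  entries are polynomials in \<open>t\<close>. So \<open>f\<close> restricts to a univariate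
  polynomial, which is nonzero because of its value at \<open>s\<close>.\<close>

lemma finite_coeff_matrix_zeros:
  fixes f :: "(nat \<times> nat, 'k::field) mpoly"
  assumes f: "f \<in> carrier (mpoly_ring ({..<Suc (length bs + length Ls)} \<times> {..N}))"
    and nz: "mpoly_eval (coeff_matrix (bs @ w # Ls)) f \<noteq> 0" and w: "curve N c s = w"
  shows "finite {t. mpoly_eval (coeff_matrix (bs @ curve N c t # Ls)) f = 0}"
proof -
  define g where "g = (\<lambda>(r, v). if r = length bs then c v else [:coeff_matrix (bs @ w # Ls) (r, v):])"
  obtain P where P: "\<And>t. mpoly_eval (\<lambda>v. poly (g v) t) f = poly P t"
    using mpoly_eval_poly [of g f] by blast
  have eq: "mpoly_eval (coeff_matrix (bs @ curve N c t # Ls)) f = poly P t" for t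
    unfolding P [symmetric]
  proof (rule mpoly_eval_cong [OF f])
    fix rv :: "nat \<times> nat" assume "rv \<in> {..<Suc (length bs + length Ls)} \<times> {..N}"
    then obtain r v where "rv = (r, v)" "v \<le> N" by auto
    then show "coeff_matrix (bs @ curve N c t # Ls) rv = poly (g rv) t"
      by (auto simp: coeff_matrix_def g_def nth_append nth_Cons lookup_curve split: nat.splits)
  qed
  have "P \<noteq> 0" using eq [of s] nz w by auto
  then show ?thesis using poly_roots_finite [of P] by (simp add: eq)
qed

text \<open>The form \<open>y\<close> is a point of one curve. Each requirement fails for only
  finitely many parameters, and an infinite field leaves a parameter satisfying all of them. Lists
  grow at the front, so \<open>bs\<close> holds the forms still to be chosen.\<close>

lemma generic_extension:
  fixes J :: "(nat, 'k::{field, ring_char_0}) mpoly set" and F :: "nat \<Rightarrow> (nat \<times> nat, 'k) mpoly"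
  assumes J: "ideal J (coord_ring N)" and Ls: "length Ls \<le> N" "set Ls \<subseteq> forms N 1"
    and F: "\<And>j. F j \<in> carrier (mpoly_ring ({..<j} \<times> {..N}))"
    and gen: "\<And>j. length Ls < j \<Longrightarrow> j \<le> n \<Longrightarrow> \<exists>bs. length bs = j - length Ls \<and> set bs \<subseteq> forms N 1 \<and>
      mpoly_eval (coeff_matrix (bs @ Ls)) (F j) \<noteq> 0"
  obtains y where "y \<in> forms N 1" "y \<notin> polys.span (set Ls)"
    "\<And>g. g \<in> forms N d \<Longrightarrow> y * g \<in> J \<Longrightarrow> g \<in> saturation N J"
    "\<And>j. length Ls < j \<Longrightarrow> j \<le> n \<Longrightarrow> \<exists>bs. length bs = j - Suc (length Ls) \<and> set bs \<subseteq> forms N 1 \<and>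
      mpoly_eval (coeff_matrix (bs @ y # Ls)) (F j) \<noteq> 0"
proof -
  define R where "R j bs w \<longleftrightarrow> length bs = j - Suc (length Ls) \<and> set bs \<subseteq> forms N 1 \<and> w \<in> forms N 1 \<and>
      mpoly_eval (coeff_matrix (bs @ w # Ls)) (F j) \<noteq> 0" for j bs w
  have "\<exists>bs w. R j bs w" if j: "length Ls < j" "j \<le> n" for j
  proof -
    obtain bs where bs: "length bs = j - length Ls" "set bs \<subseteq> forms N 1"
      "mpoly_eval (coeff_matrix (bs @ Ls)) (F j) \<noteq> 0"
      using gen [OF j] by blast
    \<comment> \<open>The last entry of \<open>bs\<close> stands next to \<open>Ls\<close>; it is
      the one that the new form will replace.\<close>
    then obtain bs' w where "bs = bs' @ [w]"
      using j by (cases bs rule: rev_cases) auto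
    then show ?thesis using bs unfolding R_def by (intro exI [of _ bs'] exI [of _ w]) auto
  qed
  then obtain bs w where "\<And>j. length Ls < j \<Longrightarrow> j \<le> n \<Longrightarrow> R j (bs j) (w j)"
    by metis
  then have bs: "\<And>j. length Ls < j \<Longrightarrow> j \<le> n \<Longrightarrow> length (bs j) = j - Suc (length Ls)"
      "\<And>j. length Ls < j \<Longrightarrow> j \<le> n \<Longrightarrow> set (bs j) \<subseteq> forms N 1"
      "\<And>j. length Ls < j \<Longrightarrow> j \<le> n \<Longrightarrow> w j \<in> forms N 1"
      "\<And>j. length Ls < j \<Longrightarrow> j \<le> n \<Longrightarrow> mpoly_eval (coeff_matrix (bs j @ w j # Ls)) (F j) \<noteq> 0"
    by (simp_all add: R_def)
  \<comment> \<open>The curve must meet every variable, for the nonzerodivisor and independence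
    arguments, and every \<open>w j\<close>, so that no \<open>F j\<close> vanishes identically
    along it.\<close>
  define W where "W = (\<lambda>v. monomial (var v)) ` {..N} \<union> w ` {length Ls<..n}"
  have "finite W" "W \<subseteq> forms N 1"
    using bs(3) by (auto simp: W_def)
  then obtain c s where "\<forall>x\<in>W. curve N c (s x) = x"
    using curve_through by blast
  then have c: "curve N c (s x) = x" if "x \<in> W" for x
    using that by blast
  define Z1 where "Z1 = {t. \<exists>p\<in>forms N d. p \<notin> saturation N J \<and> curve N c t * p \<in> J}"
  define Z2 where "Z2 = {t. curve N c t \<in> polys.span (set Ls)}"
  define Z3 where "Z3 j = {t. mpoly_eval (coeff_matrix (bs j @ curve N c t # Ls)) (F j) = 0}" for j
  have "finite Z1"
    unfolding Z1_def using c by (intro finite_zero_divisors_on_curve [OF J]) (auto simp: W_def)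
  \<comment> \<open>Otherwise the whole curve, and with it all \<open>N + 1\<close> variables, would
    lie in the span of at most \<open>N\<close> forms.\<close>
  moreover have "finite Z2"
  proof (rule ccontr)
    assume "infinite Z2"
    then have "curve N c t * 1 \<in> polys.span (set Ls)" for t
      by (rule curve_mult_mem [OF polys.subspace_span]) (simp add: Z2_def)
    then have "x \<in> polys.span (set Ls)" if "x \<in> W" for x
      using c [OF that] by (metis mult.right_neutral)
    then have "(monomial ` var ` {..N} :: (nat, 'k) mpoly set) \<subseteq> polys.span (set Ls)"
      by (auto simp: W_def)
    then have "card (monomial ` var ` {..N} :: (nat, 'k) mpoly set) \<le> card (set Ls)"
      using polys.independent_span_bound [OF _ independent_monomials] by blast
    moreover have "card (monomial ` var ` {..N} :: (nat, 'k) mpoly set) = Suc N"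
      by (subst card_image [OF inj_monomial]) (auto simp: card_image inj_on_def)
    ultimately show False
      using card_length [of Ls] Ls(1) by simp
  qed
  moreover have "finite (Z3 j)" if j: "length Ls < j" "j \<le> n" for j
    unfolding Z3_def
  proof (rule finite_coeff_matrix_zeros)
    show "F j \<in> carrier (mpoly_ring ({..<Suc (length (bs j) + length Ls)} \<times> {..N}))"
      using F [of j] bs(1) [OF j] j by simp
    show "curve N c (s (w j)) = w j" by (rule c) (use j in \<open>auto simp: W_def\<close>)
  qed (rule bs(4) [OF j])
  ultimately have fin: "finite (Z1 \<union> Z2 \<union> (\<Union>j\<in>{length Ls<..n}. Z3 j))"
    by simp
  obtain t where t: "t \<notin> Z1 \<union> Z2 \<union> (\<Union>j\<in>{length Ls<..n}. Z3 j)"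
    using ex_new_if_finite [OF infinite_UNIV_char_0 fin] by (rule exE)
  show ?thesis
  proof (rule that [of "curve N c t"])
    show "curve N c t \<in> forms N 1" by (rule curve_in_forms)
    show "curve N c t \<notin> polys.span (set Ls)" using t by (auto simp: Z2_def)
    show "g \<in> saturation N J" if "g \<in> forms N d" "curve N c t * g \<in> J" for g
      using t that by (auto simp: Z1_def)
    show "\<exists>bs. length bs = j - Suc (length Ls) \<and> set bs \<subseteq> forms N 1 \<and>
      mpoly_eval (coeff_matrix (bs @ curve N c t # Ls)) (F j) \<noteq> 0" if "length Ls < j" "j \<le> n" for j
      using t bs(1,2) that by (intro exI [of _ "bs j"]) (auto simp: Z3_def)
  qed
qed

subsection \<open>Condition ND\<close>

text \<open>A point of the open set gives some \<open>f\<close> in the defining family that is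
  nonzero there, and nonvanishing of this single \<open>f\<close> already forces membership in the
  open set. Here \<open>j\<close> counts equations, so the dimension is
  \<open>N - j\<close>.\<close>

lemma ND_witness:
  fixes I :: "(nat, 'k::field) mpoly set"
  assumes "ND N e I d" "e + j \<le> N"
  shows "\<exists>f \<in> carrier (mpoly_ring ({..<j} \<times> {..N})).
    (\<exists>Ls. length Ls = j \<and> set Ls \<subseteq> forms N 1 \<and> mpoly_eval (coeff_matrix Ls) f \<noteq> 0) \<and>
    (\<forall>Ls\<in>linear_equations N (N - j). mpoly_eval (coeff_matrix Ls) f \<noteq> 0 \<longrightarrow>
      section_ideal N I (genideal (coord_ring N) (set Ls)) d =
        {zero (coord_ring N Quot (genideal (coord_ring N) (set Ls)))})"
proof -
  have j: "N - (N - j) = j" using assms(2) by simp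
  have "for_general_linear_subspace N (N - j) (\<lambda>L. section_ideal N I L d = {zero (coord_ring N Quot L)})"
    using assms unfolding ND_def by auto
  then obtain U where U: "zariski_open N (N - j) U" "U \<noteq> {}"
      "\<And>L. L \<in> U \<Longrightarrow> section_ideal N I L d = {zero (coord_ring N Quot L)}"
    unfolding for_general_linear_subspace_def by blast
  obtain F where F: "U \<subseteq> linear_subspaces N (N - j)" "F \<subseteq> carrier (mpoly_ring ({..<j} \<times> {..N}))"
      "\<And>Ls. Ls \<in> linear_equations N (N - j) \<Longrightarrow> genideal (coord_ring N) (set Ls) \<in> U \<longleftrightarrow>
        (\<exists>f\<in>F. mpoly_eval (coeff_matrix Ls) f \<noteq> 0)"
    using U(1) unfolding zariski_open_def j by blast
  obtain L where "L \<in> U" using U(2) by blast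
  then obtain Ls where Ls: "Ls \<in> linear_equations N (N - j)" "L = genideal (coord_ring N) (set Ls)"
    using F(1) unfolding linear_subspaces_def by blast
  then obtain f where f: "f \<in> F" "mpoly_eval (coeff_matrix Ls) f \<noteq> 0"
    using F(3) [OF Ls(1)] \<open>L \<in> U\<close> by blast
  show ?thesis
  proof (intro bexI [of _ f] conjI ballI impI exI [of _ Ls])
    show "length Ls = j" "set Ls \<subseteq> forms N 1" using Ls(1) j by (auto simp: linear_equations_def)
    show "section_ideal N I (genideal (coord_ring N) (set Ms)) d =
        {zero (coord_ring N Quot (genideal (coord_ring N) (set Ms)))}"
      if "Ms \<in> linear_equations N (N - j)" "mpoly_eval (coeff_matrix Ms) f \<noteq> 0" for Ms
      using U(3) F(3) [OF that(1)] that(2) f(1) by blast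
  qed (use f F(2) in auto)
qed

lemma section_ideal_trivialD:
  fixes I L :: "(nat, 'k::field) mpoly set"
  assumes L: "ideal L (coord_ring N)" and triv: "section_ideal N I L d = {zero (coord_ring N Quot L)}"
    and p: "p \<in> saturation N (set_add (coord_ring N) I L)" "p \<in> forms N d"
  shows "p \<in> L"
proof -
  have "a_r_coset (coord_ring N) L p \<in> section_ideal N I L d"
    using p by (simp add: section_ideal_def)
  then have "a_r_coset (coord_ring N) L p = L"
    using triv by (simp add: FactRing_def)
  then show ?thesis
    by (rule ideal.rcos_const_imp_mem [OF L forms_carrier [OF p(2)]])
qed

lemma set_add_coord_ring: "set_add (coord_ring N) I L = {p + q |p q. p \<in> I \<and> q \<in> L}"
  by (auto simp: set_add_def')

text \<open>The linear forms \<open>y\<close> of the list are chosen one after the other. If \<open>y * g + f'\<close> lies in \<open>I\<close>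
  with \<open>f'\<close> in the ideal \<open>L\<close> of the previous ones, then \<open>y\<close> being a nonzerodivisor modulo the
  saturation of \<open>I + L\<close> and condition ND put \<open>g\<close> into \<open>L\<close>.\<close>

lemma ND_regular_flag:
  fixes I :: "(nat, 'k::{field, ring_char_0}) mpoly set"
  assumes I: "ideal I (coord_ring N)" and ND: "ND N e I d" and N: "N = n + e" and "i \<le> Suc n"
  obtains Ls where "length Ls = i" "distinct Ls" "set Ls \<subseteq> forms N 1" "polys.independent (set Ls)"
    "I \<inter> degree_piece N d (set Ls) \<subseteq> {0}"
proof -
  have "\<exists>f. f \<in> carrier (mpoly_ring ({..<j} \<times> {..N})) \<and> (j \<le> n \<longrightarrow>
    (\<exists>Ls. length Ls = j \<and> set Ls \<subseteq> forms N 1 \<and> mpoly_eval (coeff_matrix Ls) f \<noteq> 0) \<and>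
    (\<forall>Ls\<in>linear_equations N (N - j). mpoly_eval (coeff_matrix Ls) f \<noteq> 0 \<longrightarrow>
      section_ideal N I (genideal (coord_ring N) (set Ls)) d =
        {zero (coord_ring N Quot (genideal (coord_ring N) (set Ls)))}))" for j
  proof (cases "j \<le> n")
    case True
    then show ?thesis using ND_witness [OF ND, of j] N by auto
  next
    case False
    \<comment> \<open>Condition ND says nothing about more than \<open>n\<close> equations;
      \<open>0\<close> is a placeholder that makes \<open>F\<close> total.\<close>
    then show ?thesis by (intro exI [of _ 0]) (simp add: carrier_mpoly_ring)
  qed
  then obtain F where F: "\<And>j. F j \<in> carrier (mpoly_ring ({..<j} \<times> {..N}))"
    and wit: "\<And>j. j \<le> n \<Longrightarrow> \<exists>Ls. length Ls = j \<and> set Ls \<subseteq> forms N 1 \<and> mpoly_eval (coeff_matrix Ls) (F j) \<noteq> 0"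
    and triv: "\<And>j Ls. j \<le> n \<Longrightarrow> Ls \<in> linear_equations N (N - j) \<Longrightarrow> mpoly_eval (coeff_matrix Ls) (F j) \<noteq> 0 \<Longrightarrow>
      section_ideal N I (genideal (coord_ring N) (set Ls)) d =
        {zero (coord_ring N Quot (genideal (coord_ring N) (set Ls)))}"
    by metis
  \<comment> \<open>The induction also carries that, for each \<open>j\<close> from \<open>i\<close>
    to \<open>n\<close>, the list extends to \<open>j\<close> forms at which \<open>F j\<close> is
    nonzero. At \<open>i = Suc n\<close> this is vacuous: the last form is chosen after only
    \<open>n\<close> equations.\<close>
  have "\<exists>Ls. length Ls = i \<and> distinct Ls \<and> set Ls \<subseteq> forms N 1 \<and> polys.independent (set Ls) \<and>
    I \<inter> degree_piece N d (set Ls) \<subseteq> {0} \<and>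
    (\<forall>j. i \<le> j \<longrightarrow> j \<le> n \<longrightarrow> (\<exists>bs. length bs = j - i \<and> set bs \<subseteq> forms N 1 \<and>
      mpoly_eval (coeff_matrix (bs @ Ls)) (F j) \<noteq> 0))"
    using \<open>i \<le> Suc n\<close>
  proof (induction i)
    case 0
    then show ?case
      using wit by (intro exI [of _ "[]"]) (simp add: degree_piece_def polys.independent_empty)
  next
    case (Suc i)
    then obtain Ls where Ls: "length Ls = i" "distinct Ls" "set Ls \<subseteq> forms N 1" "polys.independent (set Ls)"
      "I \<inter> degree_piece N d (set Ls) \<subseteq> {0}"
      and gen: "\<And>j. i \<le> j \<Longrightarrow> j \<le> n \<Longrightarrow> \<exists>bs. length bs = j - i \<and> set bs \<subseteq> forms N 1 \<and>
        mpoly_eval (coeff_matrix (bs @ Ls)) (F j) \<noteq> 0"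
      by auto
    let ?L = "genideal (coord_ring N) (set Ls)"
    let ?J = "set_add (coord_ring N) I ?L"
    interpret ring "coord_ring N :: (nat, 'k) mpoly ring" by (rule ring_mpoly_ring)
    have carr: "set Ls \<subseteq> carrier (coord_ring N)" using Ls(3) forms_carrier by blast
    have L: "ideal ?L (coord_ring N)" by (rule genideal_ideal [OF carr])
    have J: "ideal ?J (coord_ring N)" by (rule add_ideals [OF I L])
    have "i \<le> n" using Suc.prems by simp
    have "Ls \<in> linear_equations N (N - i)"
      using Ls carr \<open>i \<le> n\<close> N independent_mpoly [OF Ls(2,4)] by (simp add: linear_equations_def)
    \<comment> \<open>For \<open>j = i\<close> the extension \<open>bs\<close> is empty, so
      condition ND applies to \<open>Ls\<close> itself.\<close>
    moreover have "mpoly_eval (coeff_matrix Ls) (F i) \<noteq> 0" using gen [of i] \<open>i \<le> n\<close> by simp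
    ultimately have sec: "section_ideal N I ?L d = {zero (coord_ring N Quot ?L)}"
      by (rule triv [OF \<open>i \<le> n\<close>])
    obtain y where y: "y \<in> forms N 1" "y \<notin> polys.span (set Ls)"
      "\<And>g. g \<in> forms N d \<Longrightarrow> y * g \<in> ?J \<Longrightarrow> g \<in> saturation N ?J"
      and gen': "\<And>j. i < j \<Longrightarrow> j \<le> n \<Longrightarrow> \<exists>bs. length bs = j - Suc i \<and> set bs \<subseteq> forms N 1 \<and>
        mpoly_eval (coeff_matrix (bs @ y # Ls)) (F j) \<noteq> 0"
    proof (rule generic_extension [OF J, of Ls F n d])
      show "length Ls \<le> N" using Ls(1) \<open>i \<le> n\<close> N by simp
    qed (use Ls F gen in auto)
    \<comment> \<open>An element of \<open>I\<close> in the enlarged piece already lies in the old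
      one, where the induction hypothesis makes it zero.\<close>
    have piece: "f \<in> degree_piece N d (set Ls)" if f: "f \<in> I" "f \<in> degree_piece N d (insert y (set Ls))" for f
    proof -
      obtain g f' where g: "g \<in> forms N d" "f' \<in> degree_piece N d (set Ls)" "f = y * g + f'"
        using f(2) by (rule degree_piece_insert)
      have "degree_piece N d (set Ls) \<subseteq> ?L"
        unfolding degree_piece_def
      proof (rule polys.span_minimal [OF _ subspace_ideal [OF L]], clarify)
        fix x q :: "(nat, 'k) mpoly" assume "x \<in> set Ls" "q \<in> forms N d"
        then have "q * x \<in> ?L"
          using genideal_self [OF carr] forms_carrier by (intro ideal_mult [OF L]) auto
        then show "x * q \<in> ?L" by (simp add: mult.commute)
      qed
      then have "f' \<in> ?L" using g(2) by blast
      then have "- f' \<in> ?L" by (rule polys.subspace_neg [OF subspace_ideal [OF L]])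
      moreover have "y * g = f + - f'" using g(3) by simp
      ultimately have "y * g \<in> ?J" using f(1) unfolding set_add_coord_ring by blast
      then have "g \<in> saturation N ?J" by (rule y(3) [OF g(1)])
      then have "g \<in> ?L" using g(1) by (rule section_ideal_trivialD [OF L sec])
      then have "y * g \<in> ?L" by (rule ideal_mult [OF L forms_carrier [OF y(1)]])
      moreover have "y * g \<in> forms N (Suc d)" using forms_mult [OF y(1) g(1)] by simp
      ultimately have "y * g \<in> degree_piece N d (set Ls)" by (rule genideal_degree_piece [OF Ls(3)])
      then show ?thesis
        using g(2,3) polys.span_add unfolding degree_piece_def by blast
    qed
    have "y \<notin> set Ls" using y(2) polys.span_base [of y "set Ls"] by auto
    moreover have "polys.independent (insert y (set Ls))"
      using y(2) Ls(4) by (rule polys.independent_insertI)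
    ultimately show ?case
      using Ls y(1) gen' piece by (intro exI [of _ "y # Ls"]) auto
  qed
  then show ?thesis using that by blast
qed

text \<open>This is the case of the whole space as linear subspace: the list of equations is empty
  and generates the zero ideal.\<close>

lemma ND_no_forms:
  fixes I :: "(nat, 'k::field) mpoly set"
  assumes I: "ideal I (coord_ring N)" and ND: "ND N e I d" and "e \<le> N" and p: "p \<in> I" "p \<in> forms N d"
  shows "p = 0"
proof -
  interpret ring "coord_ring N :: (nat, 'k) mpoly ring" by (rule ring_mpoly_ring)
  let ?L = "genideal (coord_ring N :: (nat, 'k) mpoly ring) {}"
  have "([] :: (nat, 'k) mpoly list) \<in> linear_equations N (N - 0)"
    by (simp add: linear_equations_def)
  then have sec: "section_ideal N I ?L d = {zero (coord_ring N Quot ?L)}"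
    using ND_witness [OF ND, of 0] \<open>e \<le> N\<close> by fastforce
  have L: "ideal ?L (coord_ring N)" by (rule genideal_ideal) simp
  have sat: "p \<in> saturation N (set_add (coord_ring N) I ?L)"
  proof -
    have "p + 0 \<in> set_add (coord_ring N) I ?L"
      unfolding set_add_coord_ring using p(1) polys.subspace_0 [OF subspace_ideal [OF L]] by blast
    then show ?thesis using ideal_subset_saturation [OF add_ideals [OF I L]] by auto
  qed
  have "p \<in> ?L" by (rule section_ideal_trivialD [OF L sec sat p(2)])
  moreover have "?L \<subseteq> {0}"
    using genideal_minimal [OF zeroideal, of "{}"] by simp
  ultimately show ?thesis by auto
qed

text \<open>Multiplication by the power \<open>d - i\<close> of the variable with index 0 is
  injective and lifts \<open>p\<close> to degree \<open>d\<close>.\<close>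

lemma ND_no_forms_below:
  fixes I :: "(nat, 'k::field) mpoly set"
  assumes I: "ideal I (coord_ring N)" and ND: "ND N e I d" and "e \<le> N" and p: "p \<in> I" "p \<in> forms N i" and "i \<le> d"
  shows "p = 0"
proof -
  let ?x = "monomial (Poly_Mapping.single 0 (d - i)) :: (nat, 'k) mpoly"
  have x: "?x \<in> forms N (d - i)" by (simp add: mons_def)
  have "?x * p \<in> I" using p(1) by (rule ideal_mult [OF I forms_carrier [OF x]])
  moreover have "?x * p \<in> forms N d" using forms_mult [OF x p(2)] \<open>i \<le> d\<close> by simp
  ultimately have "?x * p = 0" by (rule ND_no_forms [OF I ND \<open>e \<le> N\<close>])
  moreover have "?x \<noteq> 0" by (metis lookup_single_eq lookup_zero one_neq_zero)
  ultimately show ?thesis by simp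
qed

section \<open>Comparison of Hilbert series\<close>

theorem corollary4p2:
  fixes I :: "(nat, 'k::{alg_closed_field, field_char_0}) mpoly set"
    and n e l :: nat
    and h :: "rat poly"
  assumes "l \<ge> 1"
    and "saturated_ideal (n + e) I"
    and "has_dimension (n + e) I n"
    and "hilbert_series (n + e) I = fps_of_poly h / (1 - fps_X) ^ (n + 1)"
    and "ND (n + e) e I (l - 1)"
  shows "\<forall>i\<le>l. Polynomial.coeff h i \<ge> 0"
proof -
  define N where "N = n + e"
  obtain d where d: "l = Suc d" using assms(1) by (cases l) auto
  have I: "ideal I (coord_ring N)"
    using assms(2) by (simp add: saturated_ideal_def homogeneous_ideal_def N_def)
  have ND: "ND N e I d" using assms(5) by (simp add: d N_def)
  have "e \<le> N" by (simp add: N_def)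
  have low: "I \<inter> forms N i = {0}" if "i \<le> d" for i
    using ND_no_forms_below [OF I ND \<open>e \<le> N\<close>] that polys.subspace_0 [OF subspace_ideal [OF I]]
      polys.subspace_0 [OF subspace_forms] by auto
  have "1 \<notin> I"
  proof
    assume "1 \<in> I"
    moreover have "1 \<in> forms N 0" by (simp add: forms_keys)
    ultimately have "(1 :: (nat, 'k) mpoly) \<in> {0}" using low [of 0] by blast
    then show False by simp
  qed
  note HF = hilbert_function_eq [OF I this]
  define \<beta> where "\<beta> = polys.dim (I \<inter> forms N l)"
  obtain Ls where Ls: "length Ls = Suc n" "distinct Ls" "set Ls \<subseteq> forms N 1" "polys.independent (set Ls)"
    "I \<inter> degree_piece N d (set Ls) \<subseteq> {0}"
    by (rule ND_regular_flag [OF I ND N_def order_refl])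
  have beta: "\<beta> \<le> card (mons {..<e} l)"
    unfolding \<beta>_def d
    by (rule dim_le_card_mons [OF subspace_ideal [OF I] Ls(3,4)])
      (use Ls distinct_card [OF Ls(2)] in \<open>auto simp: N_def\<close>)
  let ?u = "1 - fps_X :: rat fps"
  let ?G = "\<lambda>V. Abs_fps (\<lambda>i. of_nat (card (mons (V :: nat set) i))) :: rat fps"
  have "?u \<noteq> 0" by (rule fps_nonzeroI [of _ 0]) simp
  then have unit: "?u ^ k \<noteq> 0" for k by simp
  \<comment> \<open>After multiplication by \<open>e\<close> further factors \<open>?u\<close> both
    sides equal 1, and these factors cancel.\<close>
  have GN: "?G {..N} * ?u ^ (n + 1) = ?G {..<e}"
  proof -
    have "(?G {..N} * ?u ^ (n + 1)) * ?u ^ e = ?G {..<e} * ?u ^ e"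
      using card_mons_fps [of "{..N}", where 'a = rat] card_mons_fps [of "{..<e}", where 'a = rat]
      by (simp add: N_def power_add mult_ac)
    then show ?thesis using unit by simp
  qed
  have h: "fps_of_poly h = hilbert_series N I * ?u ^ (n + 1)"
    using assms(4) unit by (simp add: N_def)
  \<comment> \<open>\<open>D\<close> is the generating function of the dimensions of
    \<open>I \<inter> forms N i\<close>; it starts in degree \<open>l\<close> with
    \<open>\<beta>\<close>.\<close>
  define D where "D = ?G {..N} - hilbert_series N I"
  have D_low: "fps_nth D i = 0" if "i \<le> d" for i
  proof -
    have "polys.dim (I \<inter> forms N i) = 0"
      unfolding low [OF that] by (rule polys.dim_unique [of "{}"]) (simp_all add: polys.independent_empty polys.span_empty)
    then show ?thesis using HF [of i] by (simp add: D_def hilbert_series_def)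
  qed
  have D_l: "fps_nth D l = of_nat \<beta>"
    using HF [of l] ideal_dim_le_card_mons [OF I, of l]
    by (simp add: D_def hilbert_series_def \<beta>_def of_nat_diff)
  have h_eq: "fps_of_poly h = ?G {..<e} - D * ?u ^ (n + 1)"
    unfolding h D_def GN [symmetric] by (simp add: algebra_simps)
  \<comment> \<open>Up to degree \<open>l\<close> only the constant term 1 of the power of
    \<open>?u\<close> meets a nonzero coefficient of \<open>D\<close>.\<close>
  have Du: "fps_nth (D * ?u ^ (n + 1)) i = (if i = l then of_nat \<beta> else 0)" if "i \<le> l" for i
  proof -
    have "fps_nth (D * ?u ^ (n + 1)) i = (\<Sum>k=0..i. fps_nth D k * fps_nth (?u ^ (n + 1)) (i - k))"
      by (rule fps_mult_nth)
    also have "\<dots> = (\<Sum>k=0..i. if k = l then of_nat \<beta> else 0)"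
      using that D_low by (intro sum.cong) (auto simp: D_l [unfolded d] d le_Suc_eq fps_power_zeroth)
    also have "\<dots> = (if i = l then of_nat \<beta> else 0)" using that by auto
    finally show ?thesis .
  qed
  show ?thesis
  proof (intro allI impI)
    fix i assume "i \<le> l"
    have "Polynomial.coeff h i = fps_nth (fps_of_poly h) i" by simp
    also have "\<dots> = of_nat (card (mons {..<e} i)) - (if i = l then of_nat \<beta> else 0)"
      unfolding h_eq fps_sub_nth Du [OF \<open>i \<le> l\<close>] by simp
    also have "\<dots> \<ge> 0" using beta by simp
    finally show "Polynomial.coeff h i \<ge> 0" .
  qed
qed

end
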